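(* Let $\Bbbk$ be a field of characteristic not $2$, let $\delta\in\Bbbk$ with $\delta\neq-2$, and let $\alpha\in\Bbbk^\times$. There is no tensor ideal $\mathcal I$ of $\mathcal T_{\delta,\alpha}$ for which $$\dim_{\Bbbk}\left((\mathcal T_{\delta,\alpha}/\mathcal I)(X^{\otimes 2},X^{\otimes 2})\right)\in\{1,2\}.$$
   Context: All categories are $\Bbbk$-linear; $\mathcal C(Y,Z)$ denotes the space of morphisms $Y\to Z$ in $\mathcal C$. $\mathcal T_{\delta,\alpha}$ is the strict $\Bbbk$-linear monoidal category (unit object $\mathbf 1$) generated by one object $X$ and morphisms $$m\colon X\otimes X\to X,\quad s\colon X\otimes X\to X\otimes X,\quad \eta\colon\mathbf 1\to X\otimes X,\quad \varepsilon\colon X\otimes X\to\mathbf 1,$$ subject to the following relations (writing $1$ for $\mathrm{id}_X$ and composing right to left): (i) $(\varepsilon\otimes1)(1\otimes\eta)=1=(1\otimes\varepsilon)(\eta\otimes1)$; (ii) $\sigma:=(1\otimes m)(\eta\otimes 1)=(m\otimes1)(1\otimes\eta)\colon X\to X\otimes X$; (iii) $(1\otimes\varepsilon)(s\otimes1)=(\varepsilon\otimes1)(1\otimes s)$; (iv) $s\circ s=1\otimes1$ and $(s\otimes1)(1\otimes s)(s\otimes1)=(1\otimes s)(s\otimes1)(1\otimes s)$; (v) $(1\otimes m)(s\otimes1)(1\otimes s)=s(m\otimes1)$ and $(1\otimes s)(s\otimes1)(1\otimes\sigma)=(\sigma\otimes1)s$; (vi) $\varepsilon s=\varepsilon$,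 $\; m s=-m$, $\; m\sigma=\alpha\,1$, $\;\varepsilon\eta=\delta\,\mathrm{id}_{\mathbf 1}$. A tensor ideal $\mathcal I$ of a $\Bbbk$-linear monoidal category $\mathcal C$ is a collection of subspaces $\mathcal I(Y,Z)\subseteq\mathcal C(Y,Z)$, for all objects $Y,Z$, closed under composition on either side with arbitrary morphisms of $\mathcal C$ and under tensoring on either side with identity morphisms. The quotient $\mathcal C/\mathcal I$ has the same objects as $\mathcal C$ and morphism spaces $\mathcal C(Y,Z)/\mathcal I(Y,Z)$. *)

theory Defs
  imports "Jordan_Normal_Form.VS_Connect" "HOL-Algebra.AbelCoset"
begin

section \<open>Strict linear monoidal categories, tensor ideals, quotients\<close>

text \<open>
  Morphism spaces are vector spaces over the field type \<open>'k\<close>, that is, modules over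
  \<^term>\<open>class_ring\<close>. Elements of different morphism spaces need not be distinct, so
  the operations carry the objects as arguments:
  \<open>Comp C a b c g f\<close> is \<open>g \<circ> f\<close> for \<open>f : a \<rightarrow> b\<close> and \<open>g : b \<rightarrow> c\<close>, and
  \<open>Ten C a b c d f g\<close> is \<open>f \<otimes> g : a \<otimes> c \<rightarrow> b \<otimes> d\<close> for \<open>f : a \<rightarrow> b\<close> and \<open>g : c \<rightarrow> d\<close>.
  The objects are all elements of the type \<open>'o\<close>.
\<close>

record ('o, 'a, 'k) lin_moncat =
  Hom :: "'o \<Rightarrow> 'o \<Rightarrow> ('k, 'a) module"
  Comp :: "'o \<Rightarrow> 'o \<Rightarrow> 'o \<Rightarrow> 'a \<Rightarrow> 'a \<Rightarrow> 'a"
  Idn :: "'o \<Rightarrow> 'a"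
  TenOb :: "'o \<Rightarrow> 'o \<Rightarrow> 'o"
  UnitOb :: "'o"
  Ten :: "'o \<Rightarrow> 'o \<Rightarrow> 'o \<Rightarrow> 'o \<Rightarrow> 'a \<Rightarrow> 'a \<Rightarrow> 'a"

abbreviation mor :: "('o, 'a, 'k) lin_moncat \<Rightarrow> 'o \<Rightarrow> 'o \<Rightarrow> 'a set" where
  "mor C a b \<equiv> carrier (Hom C a b)"

locale strict_linear_monoidal_category =
  fixes C :: "('o, 'a, 'k::field) lin_moncat"
  assumes hom_vectorspace: "vectorspace class_ring (Hom C a b)"
    and comp_closed: "\<lbrakk>f \<in> mor C a b; g \<in> mor C b c\<rbrakk> \<Longrightarrow> Comp C a b c g f \<in> mor C a c"
    and comp_add_left: "\<lbrakk>f \<in> mor C a b; g \<in> mor C b c; g' \<in> mor C b c\<rbrakk> \<Longrightarrow>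
      Comp C a b c (g \<oplus>\<^bsub>Hom C b c\<^esub> g') f = Comp C a b c g f \<oplus>\<^bsub>Hom C a c\<^esub> Comp C a b c g' f"
    and comp_add_right: "\<lbrakk>f \<in> mor C a b; f' \<in> mor C a b; g \<in> mor C b c\<rbrakk> \<Longrightarrow>
      Comp C a b c g (f \<oplus>\<^bsub>Hom C a b\<^esub> f') = Comp C a b c g f \<oplus>\<^bsub>Hom C a c\<^esub> Comp C a b c g f'"
    and comp_smult_left: "\<lbrakk>f \<in> mor C a b; g \<in> mor C b c\<rbrakk> \<Longrightarrow>
      Comp C a b c (r \<odot>\<^bsub>Hom C b c\<^esub> g) f = r \<odot>\<^bsub>Hom C a c\<^esub> Comp C a b c g f"
    and comp_smult_right: "\<lbrakk>f \<in> mor C a b; g \<in> mor C b c\<rbrakk> \<Longrightarrow>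
      Comp C a b c g (r \<odot>\<^bsub>Hom C a b\<^esub> f) = r \<odot>\<^bsub>Hom C a c\<^esub> Comp C a b c g f"
    and comp_assoc: "\<lbrakk>f \<in> mor C a b; g \<in> mor C b c; h \<in> mor C c d\<rbrakk> \<Longrightarrow>
      Comp C a b d (Comp C b c d h g) f = Comp C a c d h (Comp C a b c g f)"
    and id_closed: "Idn C a \<in> mor C a a"
    and id_left: "f \<in> mor C a b \<Longrightarrow> Comp C a b b (Idn C b) f = f"
    and id_right: "f \<in> mor C a b \<Longrightarrow> Comp C a a b f (Idn C a) = f"
    and ten_ob_assoc: "TenOb C (TenOb C a b) c = TenOb C a (TenOb C b c)"
    and unit_ob_left: "TenOb C (UnitOb C) a = a"
    and unit_ob_right: "TenOb C a (UnitOb C) = a"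
    and ten_closed: "\<lbrakk>f \<in> mor C a b; g \<in> mor C c d\<rbrakk> \<Longrightarrow>
      Ten C a b c d f g \<in> mor C (TenOb C a c) (TenOb C b d)"
    and ten_add_left: "\<lbrakk>f \<in> mor C a b; f' \<in> mor C a b; g \<in> mor C c d\<rbrakk> \<Longrightarrow>
      Ten C a b c d (f \<oplus>\<^bsub>Hom C a b\<^esub> f') g =
        Ten C a b c d f g \<oplus>\<^bsub>Hom C (TenOb C a c) (TenOb C b d)\<^esub> Ten C a b c d f' g"
    and ten_add_right: "\<lbrakk>f \<in> mor C a b; g \<in> mor C c d; g' \<in> mor C c d\<rbrakk> \<Longrightarrow>
      Ten C a b c d f (g \<oplus>\<^bsub>Hom C c d\<^esub> g') =
        Ten C a b c d f g \<oplus>\<^bsub>Hom C (TenOb C a c) (TenOb C b d)\<^esub> Ten C a b c d f g'"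
    and ten_smult_left: "\<lbrakk>f \<in> mor C a b; g \<in> mor C c d\<rbrakk> \<Longrightarrow>
      Ten C a b c d (r \<odot>\<^bsub>Hom C a b\<^esub> f) g =
        r \<odot>\<^bsub>Hom C (TenOb C a c) (TenOb C b d)\<^esub> Ten C a b c d f g"
    and ten_smult_right: "\<lbrakk>f \<in> mor C a b; g \<in> mor C c d\<rbrakk> \<Longrightarrow>
      Ten C a b c d f (r \<odot>\<^bsub>Hom C c d\<^esub> g) =
        r \<odot>\<^bsub>Hom C (TenOb C a c) (TenOb C b d)\<^esub> Ten C a b c d f g"
    and ten_id: "Ten C a a b b (Idn C a) (Idn C b) = Idn C (TenOb C a b)"
    and interchange:
      "\<lbrakk>f \<in> mor C a b; f' \<in> mor C b c; g \<in> mor C a' b'; g' \<in> mor C b' c'\<rbrakk> \<Longrightarrow>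
      Comp C (TenOb C a a') (TenOb C b b') (TenOb C c c') (Ten C b c b' c' f' g') (Ten C a b a' b' f g) =
        Ten C a c a' c' (Comp C a b c f' f) (Comp C a' b' c' g' g)"
    and ten_assoc: "\<lbrakk>f \<in> mor C a b; g \<in> mor C a' b'; h \<in> mor C a'' b''\<rbrakk> \<Longrightarrow>
      Ten C (TenOb C a a') (TenOb C b b') a'' b'' (Ten C a b a' b' f g) h =
        Ten C a b (TenOb C a' a'') (TenOb C b' b'') f (Ten C a' b' a'' b'' g h)"
    and ten_unit_left: "f \<in> mor C a b \<Longrightarrow>
      Ten C (UnitOb C) (UnitOb C) a b (Idn C (UnitOb C)) f = f"
    and ten_unit_right: "f \<in> mor C a b \<Longrightarrow>
      Ten C a b (UnitOb C) (UnitOb C) f (Idn C (UnitOb C)) = f"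

definition tensor_ideal ::
    "('o, 'a, 'k::field) lin_moncat \<Rightarrow> ('o \<Rightarrow> 'o \<Rightarrow> 'a set) \<Rightarrow> bool" where
  "tensor_ideal C I \<longleftrightarrow>
     (\<forall>a b. VectorSpace.subspace class_ring (I a b) (Hom C a b)) \<and>
     (\<forall>a b c. \<forall>f \<in> I a b. \<forall>g \<in> mor C b c. Comp C a b c g f \<in> I a c) \<and>
     (\<forall>a b c. \<forall>f \<in> mor C a b. \<forall>g \<in> I b c. Comp C a b c g f \<in> I a c) \<and>
     (\<forall>a b c. \<forall>f \<in> I a b. Ten C a b c c f (Idn C c) \<in> I (TenOb C a c) (TenOb C b c)) \<and>
     (\<forall>a b c. \<forall>f \<in> I a b. Ten C c c a b (Idn C c) f \<in> I (TenOb C c a) (TenOb C c b))"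

text \<open>The ring multiplication and unit of the \<open>module\<close> record play no role for vector spaces.\<close>

definition quotient_module :: "('k, 'a) module \<Rightarrow> 'a set \<Rightarrow> ('k, 'a set) module" where
  "quotient_module M N =
     \<lparr>carrier = a_rcosets\<^bsub>M\<^esub> N, mult = undefined, one = undefined,
      zero = N, add = set_add M,
      smult = (\<lambda>r A. \<Union>x\<in>A. N +>\<^bsub>M\<^esub> (r \<odot>\<^bsub>M\<^esub> x))\<rparr>"

definition quotient_category ::
    "('o, 'a, 'k) lin_moncat \<Rightarrow> ('o \<Rightarrow> 'o \<Rightarrow> 'a set) \<Rightarrow> ('o, 'a set, 'k) lin_moncat" where
  "quotient_category C I =
     \<lparr>Hom = (\<lambda>a b. quotient_module (Hom C a b) (I a b)),
      Comp = (\<lambda>a b c G F. \<Union>g\<in>G. \<Union>f\<in>F. I a c +>\<^bsub>Hom C a c\<^esub> Comp C a b c g f),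
      Idn = (\<lambda>a. I a a +>\<^bsub>Hom C a a\<^esub> Idn C a),
      TenOb = TenOb C,
      UnitOb = UnitOb C,
      Ten = (\<lambda>a b c d F G. \<Union>f\<in>F. \<Union>g\<in>G.
        I (TenOb C a c) (TenOb C b d)
          +>\<^bsub>Hom C (TenOb C a c) (TenOb C b d)\<^esub> Ten C a b c d f g)\<rparr>"

lemma submodule_of_subspace:
  assumes "VectorSpace.subspace K N V"
  shows "module K V" "abelian_group V" "N \<subseteq> carrier V" "\<zero>\<^bsub>V\<^esub> \<in> N"
    "\<And>v w. \<lbrakk>v \<in> N; w \<in> N\<rbrakk> \<Longrightarrow> v \<oplus>\<^bsub>V\<^esub> w \<in> N"
    "\<And>r v. \<lbrakk>r \<in> carrier K; v \<in> N\<rbrakk> \<Longrightarrow> r \<odot>\<^bsub>V\<^esub> v \<in> N"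
    "additive_subgroup N V"
proof -
  interpret VectorSpace.subspace K N V by fact
  interpret LinearCombinations.submodule K N V by (rule submod)
  interpret M: Module.module K V by (rule module)
  show "module K V" "abelian_group V" by unfold_locales
  show "N \<subseteq> carrier V" "\<zero>\<^bsub>V\<^esub> \<in> N" by (rule subset, rule zero_closed)
  show add: "v \<oplus>\<^bsub>V\<^esub> w \<in> N" if "v \<in> N" "w \<in> N" for v w using that by (rule m_closed)
  show smult: "r \<odot>\<^bsub>V\<^esub> v \<in> N" if "r \<in> carrier K" "v \<in> N" for r v using that by (rule smult_closed)
  have "\<ominus>\<^bsub>V\<^esub> v \<in> N" if "v \<in> N" for v
  proof -
    have "(\<ominus>\<^bsub>K\<^esub> \<one>\<^bsub>K\<^esub>) \<odot>\<^bsub>V\<^esub> v = \<ominus>\<^bsub>V\<^esub> v"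
      using that subset M.smult_l_minus[of "\<one>\<^bsub>K\<^esub>" v] M.smult_one[of v] by (auto simp: subset_iff)
    moreover have "\<ominus>\<^bsub>K\<^esub> \<one>\<^bsub>K\<^esub> \<in> carrier K" by simp
    ultimately show ?thesis using smult that by metis
  qed
  then have "subgroup N (add_monoid V)"
    using subset add zero_closed unfolding subgroup_def a_inv_def[symmetric] by simp
  then show "additive_subgroup N V" by (rule additive_subgroup.intro)
qed

context
  fixes K :: "'k ring" and N :: "'a set" and V :: "('k, 'a) module"
  assumes sub: "VectorSpace.subspace K N V"
begin

interpretation V: Module.module K V by (rule submodule_of_subspace[OF sub])
interpretation N: abelian_subgroup N V
  by (rule abelian_subgroupI3) (rule submodule_of_subspace[OF sub])+

lemma coset_mem: "v \<in> carrier V \<Longrightarrow> v \<in> N +>\<^bsub>V\<^esub> v"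
  by (rule N.a_rcos_self)

lemma coset_eq:
  assumes "v \<in> carrier V" "w \<in> N +>\<^bsub>V\<^esub> v"
  shows "w \<in> carrier V" "w \<ominus>\<^bsub>V\<^esub> v \<in> N" "N +>\<^bsub>V\<^esub> w = N +>\<^bsub>V\<^esub> v"
  using N.a_elemrcos_carrier[OF assms] N.a_rcos_module_imp[OF assms] N.a_repr_independence'[OF assms(2,1)]
  by (simp_all add: a_minus_def)

lemma coset_eqI:
  assumes "v \<in> carrier V" "w \<in> carrier V" "w \<ominus>\<^bsub>V\<^esub> v \<in> N"
  shows "N +>\<^bsub>V\<^esub> w = N +>\<^bsub>V\<^esub> v"
  using N.a_repr_independence'[OF N.a_rcos_module_rev[OF assms(1,2)] assms(1)] assms(3)
  by (simp add: a_minus_def)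

lemma quotient_carrier: "carrier (quotient_module V N) = (\<lambda>v. N +>\<^bsub>V\<^esub> v) ` carrier V"
  by (auto simp: quotient_module_def A_RCOSETS_def RCOSETS_def a_r_coset_def)

lemma quotient_zero: "\<zero>\<^bsub>quotient_module V N\<^esub> = N +>\<^bsub>V\<^esub> \<zero>\<^bsub>V\<^esub>"
  using N.a_rcos_const[OF submodule_of_subspace(4)[OF sub]] by (simp add: quotient_module_def)

lemma quotient_add: "\<lbrakk>v \<in> carrier V; w \<in> carrier V\<rbrakk> \<Longrightarrow>
    (N +>\<^bsub>V\<^esub> v) \<oplus>\<^bsub>quotient_module V N\<^esub> (N +>\<^bsub>V\<^esub> w) = N +>\<^bsub>V\<^esub> (v \<oplus>\<^bsub>V\<^esub> w)"
  by (simp add: quotient_module_def N.a_rcos_sum)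

lemma coset_UN:
  assumes "v \<in> carrier V" "\<And>w. w \<in> N +>\<^bsub>V\<^esub> v \<Longrightarrow> h w = h v"
  shows "(\<Union>w\<in>N +>\<^bsub>V\<^esub> v. h w) = h v"
proof -
  have "(\<Union>w\<in>N +>\<^bsub>V\<^esub> v. h w) = (\<Union>w\<in>N +>\<^bsub>V\<^esub> v. h v)"
    by (rule SUP_cong[OF HOL.refl assms(2)])
  then show ?thesis using coset_mem[OF assms(1)] by auto
qed

lemma quotient_smult:
  assumes "v \<in> carrier V" "r \<in> carrier K"
  shows "r \<odot>\<^bsub>quotient_module V N\<^esub> (N +>\<^bsub>V\<^esub> v) = N +>\<^bsub>V\<^esub> (r \<odot>\<^bsub>V\<^esub> v)"
proof -
  have "N +>\<^bsub>V\<^esub> (r \<odot>\<^bsub>V\<^esub> w) = N +>\<^bsub>V\<^esub> (r \<odot>\<^bsub>V\<^esub> v)" if w: "w \<in> N +>\<^bsub>V\<^esub> v" for w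
  proof (rule coset_eqI)
    note w' = coset_eq[OF assms(1) w]
    have "r \<odot>\<^bsub>V\<^esub> (w \<ominus>\<^bsub>V\<^esub> v) = r \<odot>\<^bsub>V\<^esub> w \<ominus>\<^bsub>V\<^esub> r \<odot>\<^bsub>V\<^esub> v"
      using assms w' by (simp add: a_minus_def V.smult_r_distr V.smult_r_minus)
    then show "r \<odot>\<^bsub>V\<^esub> w \<ominus>\<^bsub>V\<^esub> r \<odot>\<^bsub>V\<^esub> v \<in> N"
      using submodule_of_subspace(6)[OF sub assms(2) w'(2)] by simp
    show "r \<odot>\<^bsub>V\<^esub> v \<in> carrier V" "r \<odot>\<^bsub>V\<^esub> w \<in> carrier V" using assms w' by auto
  qed
  then show ?thesis
    using coset_UN[of v "\<lambda>w. N +>\<^bsub>V\<^esub> (r \<odot>\<^bsub>V\<^esub> w)"] assms by (simp add: quotient_module_def)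
qed

lemma quotient_vectorspace: "vectorspace K (quotient_module V N)"
proof -
  note S = quotient_carrier quotient_zero quotient_add quotient_smult
  have "abelian_group (quotient_module V N)"
  proof (rule abelian_groupI)
    fix x assume "x \<in> carrier (quotient_module V N)"
    then obtain v where "x = N +>\<^bsub>V\<^esub> v" "v \<in> carrier V" by (auto simp: S)
    then show "\<exists>y\<in>carrier (quotient_module V N).
        y \<oplus>\<^bsub>quotient_module V N\<^esub> x = \<zero>\<^bsub>quotient_module V N\<^esub>"
      by (intro bexI[of _ "N +>\<^bsub>V\<^esub> (\<ominus>\<^bsub>V\<^esub> v)"]) (auto simp: S V.l_neg)
  next
    fix x y assume "x \<in> carrier (quotient_module V N)" "y \<in> carrier (quotient_module V N)"
    then show "x \<oplus>\<^bsub>quotient_module V N\<^esub> y = y \<oplus>\<^bsub>quotient_module V N\<^esub> x"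
      by (auto simp: S V.a_comm)
  qed (auto simp: S V.a_assoc)
  then have "module K (quotient_module V N)"
    by (intro moduleI V.R.is_cring)
      (auto simp: S V.smult_l_distr V.smult_r_distr V.smult_assoc1)
  moreover have "field K"
    using sub unfolding VectorSpace.subspace_def vectorspace_def by auto
  ultimately show ?thesis by (intro vectorspace.intro)
qed

end

lemma coset_UN2:
  fixes K K' :: "'k ring" and V V' :: "('k, 'a) module"
  assumes "VectorSpace.subspace K N V" "v \<in> carrier V"
    and "VectorSpace.subspace K' N' V'" "v' \<in> carrier V'"
    and "\<And>w w'. \<lbrakk>w \<in> N +>\<^bsub>V\<^esub> v; w' \<in> N' +>\<^bsub>V'\<^esub> v'\<rbrakk> \<Longrightarrow> h w w' = h v v'"
  shows "(\<Union>w\<in>N +>\<^bsub>V\<^esub> v. \<Union>w'\<in>N' +>\<^bsub>V'\<^esub> v'. h w w') = h v v'"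
proof -
  have "(\<Union>w\<in>N +>\<^bsub>V\<^esub> v. \<Union>w'\<in>N' +>\<^bsub>V'\<^esub> v'. h w w') = (\<Union>w\<in>N +>\<^bsub>V\<^esub> v. \<Union>w'\<in>N' +>\<^bsub>V'\<^esub> v'. h v v')"
    using assms(5) by (intro SUP_cong) auto
  then show ?thesis
    using coset_mem[OF assms(1,2)] coset_mem[OF assms(3,4)] by auto
qed

lemma linear_diff:
  assumes "vectorspace (class_ring :: 'k::field ring) V" "vectorspace class_ring W"
    and add: "\<And>x y. \<lbrakk>x \<in> carrier V; y \<in> carrier V\<rbrakk> \<Longrightarrow> h (x \<oplus>\<^bsub>V\<^esub> y) = h x \<oplus>\<^bsub>W\<^esub> h y"
    and smult: "\<And>r x. x \<in> carrier V \<Longrightarrow> h (r \<odot>\<^bsub>V\<^esub> x) = r \<odot>\<^bsub>W\<^esub> h x"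
    and closed: "\<And>x. x \<in> carrier V \<Longrightarrow> h x \<in> carrier W"
    and x: "x \<in> carrier V" "y \<in> carrier V"
  shows "h (x \<ominus>\<^bsub>V\<^esub> y) = h x \<ominus>\<^bsub>W\<^esub> h y"
proof -
  interpret V: vectorspace "class_ring :: 'k ring" V by fact
  interpret W: vectorspace "class_ring :: 'k ring" W by fact
  have "h \<zero>\<^bsub>V\<^esub> = h (0 \<odot>\<^bsub>V\<^esub> y)" using V.smult_l_null[of y] x by simp
  then have zero: "h \<zero>\<^bsub>V\<^esub> = \<zero>\<^bsub>W\<^esub>" using smult[of y 0] W.smult_l_null[of "h y"] x closed by simp
  have "h (\<ominus>\<^bsub>V\<^esub> y) \<oplus>\<^bsub>W\<^esub> h y = \<zero>\<^bsub>W\<^esub>"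
    using add[of "\<ominus>\<^bsub>V\<^esub> y" y] x zero V.l_neg by simp
  then have "h (\<ominus>\<^bsub>V\<^esub> y) = \<ominus>\<^bsub>W\<^esub> h y"
    using x closed by (intro W.minus_equality[symmetric]) auto
  then show ?thesis using add[of x "\<ominus>\<^bsub>V\<^esub> y"] x by (simp add: a_minus_def)
qed

context strict_linear_monoidal_category
begin

lemma comp_diff_left: "\<lbrakk>f \<in> mor C a b; g \<in> mor C b c; g' \<in> mor C b c\<rbrakk> \<Longrightarrow>
    Comp C a b c (g \<ominus>\<^bsub>Hom C b c\<^esub> g') f = Comp C a b c g f \<ominus>\<^bsub>Hom C a c\<^esub> Comp C a b c g' f"
  by (rule linear_diff[where h = "\<lambda>g. Comp C a b c g f"])
    (auto intro: hom_vectorspace comp_add_left comp_smult_left comp_closed)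

lemma comp_diff_right: "\<lbrakk>f \<in> mor C a b; f' \<in> mor C a b; g \<in> mor C b c\<rbrakk> \<Longrightarrow>
    Comp C a b c g (f \<ominus>\<^bsub>Hom C a b\<^esub> f') = Comp C a b c g f \<ominus>\<^bsub>Hom C a c\<^esub> Comp C a b c g f'"
  by (rule linear_diff[where h = "\<lambda>f. Comp C a b c g f"])
    (auto intro: hom_vectorspace comp_add_right comp_smult_right comp_closed)

lemma ten_diff_left: "\<lbrakk>f \<in> mor C a b; f' \<in> mor C a b; g \<in> mor C c d\<rbrakk> \<Longrightarrow>
    Ten C a b c d (f \<ominus>\<^bsub>Hom C a b\<^esub> f') g =
      Ten C a b c d f g \<ominus>\<^bsub>Hom C (TenOb C a c) (TenOb C b d)\<^esub> Ten C a b c d f' g"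
  by (rule linear_diff[where h = "\<lambda>f. Ten C a b c d f g"])
    (auto intro: hom_vectorspace ten_add_left ten_smult_left ten_closed)

lemma ten_diff_right: "\<lbrakk>f \<in> mor C a b; g \<in> mor C c d; g' \<in> mor C c d\<rbrakk> \<Longrightarrow>
    Ten C a b c d f (g \<ominus>\<^bsub>Hom C c d\<^esub> g') =
      Ten C a b c d f g \<ominus>\<^bsub>Hom C (TenOb C a c) (TenOb C b d)\<^esub> Ten C a b c d f g'"
  by (rule linear_diff[where h = "\<lambda>g. Ten C a b c d f g"])
    (auto intro: hom_vectorspace ten_add_right ten_smult_right ten_closed)

end

locale linear_monoidal_ideal = strict_linear_monoidal_category +
  fixes I
  assumes ideal: "tensor_ideal C I"
begin

abbreviation Q where "Q \<equiv> quotient_category C I"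

abbreviation coset where "coset a b f \<equiv> I a b +>\<^bsub>Hom C a b\<^esub> f"

lemma subspace: "VectorSpace.subspace class_ring (I a b) (Hom C a b)"
  and ideal_comp_left: "\<lbrakk>f \<in> I a b; g \<in> mor C b c\<rbrakk> \<Longrightarrow> Comp C a b c g f \<in> I a c"
  and ideal_comp_right: "\<lbrakk>f \<in> mor C a b; g \<in> I b c\<rbrakk> \<Longrightarrow> Comp C a b c g f \<in> I a c"
  and ideal_ten_right: "f \<in> I a b \<Longrightarrow> Ten C a b c c f (Idn C c) \<in> I (TenOb C a c) (TenOb C b c)"
  and ideal_ten_left: "f \<in> I a b \<Longrightarrow> Ten C c c a b (Idn C c) f \<in> I (TenOb C c a) (TenOb C c b)"
  using ideal unfolding tensor_ideal_def by auto

lemma ideal_mor: "f \<in> I a b \<Longrightarrow> f \<in> mor C a b"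
  using submodule_of_subspace(3)[OF subspace] by auto

lemma ideal_ten1:
  assumes "f \<in> I a b" "g \<in> mor C c d"
  shows "Ten C a b c d f g \<in> I (TenOb C a c) (TenOb C b d)"
proof -
  have "Comp C (TenOb C a c) (TenOb C b c) (TenOb C b d)
      (Ten C b b c d (Idn C b) g) (Ten C a b c c f (Idn C c)) = Ten C a b c d f g"
    using assms ideal_mor by (simp add: interchange id_closed id_left id_right)
  then show ?thesis
    using ideal_comp_left[OF ideal_ten_right[OF assms(1)] ten_closed[OF id_closed assms(2)]] by simp
qed

lemma ideal_ten2:
  assumes "f \<in> mor C a b" "g \<in> I c d"
  shows "Ten C a b c d f g \<in> I (TenOb C a c) (TenOb C b d)"
proof -
  have "Comp C (TenOb C a c) (TenOb C a d) (TenOb C b d)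
      (Ten C a b d d f (Idn C d)) (Ten C a a c d (Idn C a) g) = Ten C a b c d f g"
    using assms ideal_mor by (simp add: interchange id_closed id_left id_right)
  then show ?thesis
    using ideal_comp_left[OF ideal_ten_left[OF assms(2)] ten_closed[OF assms(1) id_closed]] by simp
qed

lemma Q_comp:
  assumes "f \<in> mor C a b" "g \<in> mor C b c"
  shows "Comp Q a b c (coset b c g) (coset a b f) = coset a c (Comp C a b c g f)"
proof -
  have "coset a c (Comp C a b c g' f') = coset a c (Comp C a b c g f)"
    if g': "g' \<in> coset b c g" and f': "f' \<in> coset a b f" for g' f'
  proof -
    note G = coset_eq[OF subspace assms(2) g'] and F = coset_eq[OF subspace assms(1) f']
    have "coset a c (Comp C a b c g' f') = coset a c (Comp C a b c g f')"
      using G F assms ideal_comp_right[OF F(1) G(2)]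
      by (intro coset_eqI[OF subspace]) (auto simp: comp_closed comp_diff_left)
    also have "\<dots> = coset a c (Comp C a b c g f)"
      using F assms ideal_comp_left[OF F(2) assms(2)]
      by (intro coset_eqI[OF subspace]) (auto simp: comp_closed comp_diff_right)
    finally show ?thesis .
  qed
  then show ?thesis
    using coset_UN2[OF subspace assms(2) subspace assms(1),
        of "\<lambda>g f. coset a c (Comp C a b c g f)"]
    by (simp add: quotient_category_def)
qed

lemma Q_ten:
  assumes "f \<in> mor C a b" "g \<in> mor C c d"
  shows "Ten Q a b c d (coset a b f) (coset c d g) =
    coset (TenOb C a c) (TenOb C b d) (Ten C a b c d f g)"
proof -
  let ?q = "coset (TenOb C a c) (TenOb C b d)"
  have "?q (Ten C a b c d f' g') = ?q (Ten C a b c d f g)"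
    if f': "f' \<in> coset a b f" and g': "g' \<in> coset c d g" for f' g'
  proof -
    note G = coset_eq[OF subspace assms(2) g'] and F = coset_eq[OF subspace assms(1) f']
    have "?q (Ten C a b c d f' g') = ?q (Ten C a b c d f g')"
      using G F assms ideal_ten1[OF F(2) G(1)]
      by (intro coset_eqI[OF subspace]) (auto simp: ten_closed ten_diff_left)
    also have "\<dots> = ?q (Ten C a b c d f g)"
      using G assms ideal_ten2[OF assms(1) G(2)]
      by (intro coset_eqI[OF subspace]) (auto simp: ten_closed ten_diff_right)
    finally show ?thesis .
  qed
  then show ?thesis
    using coset_UN2[OF subspace assms(1) subspace assms(2),
        of "\<lambda>f g. ?q (Ten C a b c d f g)"]
    by (simp add: quotient_category_def)
qed

lemma Q_simps:
  "Hom Q a b = quotient_module (Hom C a b) (I a b)"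
  "Idn Q a = coset a a (Idn C a)" "TenOb Q = TenOb C" "UnitOb Q = UnitOb C"
  by (simp_all add: quotient_category_def)

theorem quotient_strict_linear_monoidal: "strict_linear_monoidal_category Q"
proof -
  note S = Q_simps quotient_carrier[OF subspace] Q_comp Q_ten
    quotient_add[OF subspace] quotient_smult[OF subspace]
    comp_closed ten_closed id_closed ten_ob_assoc unit_ob_left unit_ob_right
  have add: "\<And>a b f g. \<lbrakk>f \<in> mor C a b; g \<in> mor C a b\<rbrakk> \<Longrightarrow> f \<oplus>\<^bsub>Hom C a b\<^esub> g \<in> mor C a b"
    and smult: "\<And>a b f r. f \<in> mor C a b \<Longrightarrow> r \<odot>\<^bsub>Hom C a b\<^esub> f \<in> mor C a b"
    using submodule_of_subspace(1)[OF subspace]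
    by (auto simp: Module.module_def module_axioms_def
        intro: abelian_monoid.a_closed abelian_group.axioms)
  show ?thesis
  proof (rule strict_linear_monoidal_category.intro)
    fix a b
    show "vectorspace class_ring (Hom Q a b)"
      by (simp add: Q_simps quotient_vectorspace[OF subspace])
  next
    fix f a b f' c g a' b' g' c'
    assume "f \<in> mor Q a b" "f' \<in> mor Q b c" "g \<in> mor Q a' b'" "g' \<in> mor Q b' c'"
    then show "Comp Q (TenOb Q a a') (TenOb Q b b') (TenOb Q c c')
        (Ten Q b c b' c' f' g') (Ten Q a b a' b' f g) =
      Ten Q a c a' c' (Comp Q a b c f' f) (Comp Q a' b' c' g' g)"
      by (auto simp: S interchange)
  next
    fix f a b g a' b' h a'' b''
    assume "f \<in> mor Q a b" "g \<in> mor Q a' b'" "h \<in> mor Q a'' b''"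
    then obtain f0 g0 h0 where *: "f0 \<in> mor C a b" "g0 \<in> mor C a' b'" "h0 \<in> mor C a'' b''"
      "f = coset a b f0" "g = coset a' b' g0" "h = coset a'' b'' h0"
      by (auto simp: S)
    have "Ten Q (TenOb C a a') (TenOb C b b') a'' b'' (Ten Q a b a' b' f g) h =
      coset (TenOb C (TenOb C a a') a'') (TenOb C (TenOb C b b') b'')
        (Ten C (TenOb C a a') (TenOb C b b') a'' b'' (Ten C a b a' b' f0 g0) h0)"
      unfolding * by (simp only: Q_ten * ten_closed)
    also have "\<dots> = Ten Q a b (TenOb C a' a'') (TenOb C b' b'') f (Ten Q a' b' a'' b'' g h)"
      unfolding * by (simp only: Q_ten * ten_closed ten_assoc ten_ob_assoc)
    finally show "Ten Q (TenOb Q a a') (TenOb Q b b') a'' b'' (Ten Q a b a' b' f g) h =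
      Ten Q a b (TenOb Q a' a'') (TenOb Q b' b'') f (Ten Q a' b' a'' b'' g h)"
      by (simp add: Q_simps)
  next
    fix f a b assume "f \<in> mor Q a b"
    then obtain f0 where *: "f0 \<in> mor C a b" "f = coset a b f0" by (auto simp: S)
    show "Ten Q (UnitOb Q) (UnitOb Q) a b (Idn Q (UnitOb Q)) f = f"
      unfolding Q_simps * by (simp only: Q_ten * id_closed ten_unit_left unit_ob_left)
    show "Ten Q a b (UnitOb Q) (UnitOb Q) f (Idn Q (UnitOb Q)) = f"
      unfolding Q_simps * by (simp only: Q_ten * id_closed ten_unit_right unit_ob_right)
  qed (auto simp: S add smult comp_add_left comp_add_right comp_smult_left comp_smult_right
      comp_assoc id_left id_right ten_add_left ten_add_right ten_smult_left ten_smult_right ten_id)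
qed

end

section \<open>The category presented by generators and relations\<close>

text \<open>
  The object \<open>n :: nat\<close> stands for the \<open>n\<close>-fold tensor power of the generating object \<open>X\<close>;
  the unit object is \<open>0\<close>, the tensor product of objects is addition.
  Morphisms are formal expressions modulo the least congruence containing the axioms of
  a strict linear monoidal category and the defining relations.
\<close>

datatype 'k expr =
    GenM | GenS | GenEta | GenEps
  | EId nat
  | EComp "'k expr" "'k expr"  (infixl \<open>\<circ>\<^sub>e\<close> 65)
  | ETen "'k expr" "'k expr"  (infixl \<open>\<otimes>\<^sub>e\<close> 70)
  | EZero nat nat
  | EAdd "'k expr" "'k expr"  (infixl \<open>+\<^sub>e\<close> 60)
  | EScale 'k "'k expr"  (infixr \<open>*\<^sub>e\<close> 75)

inductive typed :: "'k expr \<Rightarrow> nat \<Rightarrow> nat \<Rightarrow> bool" where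
  "typed GenM 2 1"
| "typed GenS 2 2"
| "typed GenEta 0 2"
| "typed GenEps 2 0"
| "typed (EId n) n n"
| "\<lbrakk>typed f a b; typed g b c\<rbrakk> \<Longrightarrow> typed (g \<circ>\<^sub>e f) a c"
| "\<lbrakk>typed f a b; typed g c d\<rbrakk> \<Longrightarrow> typed (f \<otimes>\<^sub>e g) (a + c) (b + d)"
| "typed (EZero a b) a b"
| "\<lbrakk>typed f a b; typed g a b\<rbrakk> \<Longrightarrow> typed (f +\<^sub>e g) a b"
| "typed f a b \<Longrightarrow> typed (r *\<^sub>e f) a b"

abbreviation EOne :: "'k expr" (\<open>\<one>\<^sub>e\<close>) where
  "\<one>\<^sub>e \<equiv> EId 1"

definition sigma :: "'k expr" where
  "sigma = (\<one>\<^sub>e \<otimes>\<^sub>e GenM) \<circ>\<^sub>e (GenEta \<otimes>\<^sub>e \<one>\<^sub>e)"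

inductive T_rel :: "'k::field \<Rightarrow> 'k \<Rightarrow> 'k expr \<Rightarrow> 'k expr \<Rightarrow> nat \<Rightarrow> nat \<Rightarrow> bool"
  for \<delta> \<alpha> where
  zigzag_left: "T_rel \<delta> \<alpha> ((GenEps \<otimes>\<^sub>e \<one>\<^sub>e) \<circ>\<^sub>e (\<one>\<^sub>e \<otimes>\<^sub>e GenEta)) \<one>\<^sub>e 1 1"
| zigzag_right: "T_rel \<delta> \<alpha> \<one>\<^sub>e ((\<one>\<^sub>e \<otimes>\<^sub>e GenEps) \<circ>\<^sub>e (GenEta \<otimes>\<^sub>e \<one>\<^sub>e)) 1 1"
| sigma_eq: "T_rel \<delta> \<alpha> sigma ((GenM \<otimes>\<^sub>e \<one>\<^sub>e) \<circ>\<^sub>e (\<one>\<^sub>e \<otimes>\<^sub>e GenEta)) 1 2"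
| eps_s_slide:
    "T_rel \<delta> \<alpha> ((\<one>\<^sub>e \<otimes>\<^sub>e GenEps) \<circ>\<^sub>e (GenS \<otimes>\<^sub>e \<one>\<^sub>e)) ((GenEps \<otimes>\<^sub>e \<one>\<^sub>e) \<circ>\<^sub>e (\<one>\<^sub>e \<otimes>\<^sub>e GenS)) 3 1"
| s_involution: "T_rel \<delta> \<alpha> (GenS \<circ>\<^sub>e GenS) (\<one>\<^sub>e \<otimes>\<^sub>e \<one>\<^sub>e) 2 2"
| braid:
    "T_rel \<delta> \<alpha> ((GenS \<otimes>\<^sub>e \<one>\<^sub>e) \<circ>\<^sub>e (\<one>\<^sub>e \<otimes>\<^sub>e GenS) \<circ>\<^sub>e (GenS \<otimes>\<^sub>e \<one>\<^sub>e))
      ((\<one>\<^sub>e \<otimes>\<^sub>e GenS) \<circ>\<^sub>e (GenS \<otimes>\<^sub>e \<one>\<^sub>e) \<circ>\<^sub>e (\<one>\<^sub>e \<otimes>\<^sub>e GenS)) 3 3"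
| m_natural:
    "T_rel \<delta> \<alpha> ((\<one>\<^sub>e \<otimes>\<^sub>e GenM) \<circ>\<^sub>e (GenS \<otimes>\<^sub>e \<one>\<^sub>e) \<circ>\<^sub>e (\<one>\<^sub>e \<otimes>\<^sub>e GenS))
      (GenS \<circ>\<^sub>e (GenM \<otimes>\<^sub>e \<one>\<^sub>e)) 3 2"
| sigma_natural:
    "T_rel \<delta> \<alpha> ((\<one>\<^sub>e \<otimes>\<^sub>e GenS) \<circ>\<^sub>e (GenS \<otimes>\<^sub>e \<one>\<^sub>e) \<circ>\<^sub>e (\<one>\<^sub>e \<otimes>\<^sub>e sigma))
      ((sigma \<otimes>\<^sub>e \<one>\<^sub>e) \<circ>\<^sub>e GenS) 2 3"
| eps_symmetric: "T_rel \<delta> \<alpha> (GenEps \<circ>\<^sub>e GenS) GenEps 2 0"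
| m_antisymmetric: "T_rel \<delta> \<alpha> (GenM \<circ>\<^sub>e GenS) ((- 1) *\<^sub>e GenM) 2 1"
| m_sigma: "T_rel \<delta> \<alpha> (GenM \<circ>\<^sub>e sigma) (\<alpha> *\<^sub>e \<one>\<^sub>e) 1 1"
| eps_eta: "T_rel \<delta> \<alpha> (GenEps \<circ>\<^sub>e GenEta) (\<delta> *\<^sub>e EId 0) 0 0"

inductive T_cong :: "'k::field \<Rightarrow> 'k \<Rightarrow> 'k expr \<Rightarrow> 'k expr \<Rightarrow> nat \<Rightarrow> nat \<Rightarrow> bool"
  for \<delta> \<alpha> where
  rel: "T_rel \<delta> \<alpha> f g a b \<Longrightarrow> T_cong \<delta> \<alpha> f g a b"
| refl: "typed f a b \<Longrightarrow> T_cong \<delta> \<alpha> f f a b"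
| sym: "T_cong \<delta> \<alpha> f g a b \<Longrightarrow> T_cong \<delta> \<alpha> g f a b"
| trans: "\<lbrakk>T_cong \<delta> \<alpha> f g a b; T_cong \<delta> \<alpha> g h a b\<rbrakk> \<Longrightarrow> T_cong \<delta> \<alpha> f h a b"
| comp_cong: "\<lbrakk>T_cong \<delta> \<alpha> f f' a b; T_cong \<delta> \<alpha> g g' b c\<rbrakk> \<Longrightarrow> T_cong \<delta> \<alpha> (g \<circ>\<^sub>e f) (g' \<circ>\<^sub>e f') a c"
| ten_cong: "\<lbrakk>T_cong \<delta> \<alpha> f f' a b; T_cong \<delta> \<alpha> g g' c d\<rbrakk> \<Longrightarrow>
    T_cong \<delta> \<alpha> (f \<otimes>\<^sub>e g) (f' \<otimes>\<^sub>e g') (a + c) (b + d)"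
| add_cong: "\<lbrakk>T_cong \<delta> \<alpha> f f' a b; T_cong \<delta> \<alpha> g g' a b\<rbrakk> \<Longrightarrow> T_cong \<delta> \<alpha> (f +\<^sub>e g) (f' +\<^sub>e g') a b"
| scale_cong: "T_cong \<delta> \<alpha> f f' a b \<Longrightarrow> T_cong \<delta> \<alpha> (r *\<^sub>e f) (r *\<^sub>e f') a b"
| add_assoc: "\<lbrakk>typed f a b; typed g a b; typed h a b\<rbrakk> \<Longrightarrow>
    T_cong \<delta> \<alpha> (f +\<^sub>e g +\<^sub>e h) (f +\<^sub>e (g +\<^sub>e h)) a b"
| add_comm: "\<lbrakk>typed f a b; typed g a b\<rbrakk> \<Longrightarrow> T_cong \<delta> \<alpha> (f +\<^sub>e g) (g +\<^sub>e f) a b"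
| add_zero: "typed f a b \<Longrightarrow> T_cong \<delta> \<alpha> (EZero a b +\<^sub>e f) f a b"
| add_neg: "typed f a b \<Longrightarrow> T_cong \<delta> \<alpha> ((- 1) *\<^sub>e f +\<^sub>e f) (EZero a b) a b"
| scale_add: "\<lbrakk>typed f a b; typed g a b\<rbrakk> \<Longrightarrow> T_cong \<delta> \<alpha> (r *\<^sub>e (f +\<^sub>e g)) (r *\<^sub>e f +\<^sub>e r *\<^sub>e g) a b"
| add_scale: "typed f a b \<Longrightarrow> T_cong \<delta> \<alpha> ((r + r') *\<^sub>e f) (r *\<^sub>e f +\<^sub>e r' *\<^sub>e f) a b"
| scale_scale: "typed f a b \<Longrightarrow> T_cong \<delta> \<alpha> ((r * r') *\<^sub>e f) (r *\<^sub>e r' *\<^sub>e f) a b"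
| one_scale: "typed f a b \<Longrightarrow> T_cong \<delta> \<alpha> (1 *\<^sub>e f) f a b"
| comp_assoc: "\<lbrakk>typed f a b; typed g b c; typed h c d\<rbrakk> \<Longrightarrow>
    T_cong \<delta> \<alpha> (h \<circ>\<^sub>e g \<circ>\<^sub>e f) (h \<circ>\<^sub>e (g \<circ>\<^sub>e f)) a d"
| id_left: "typed f a b \<Longrightarrow> T_cong \<delta> \<alpha> (EId b \<circ>\<^sub>e f) f a b"
| id_right: "typed f a b \<Longrightarrow> T_cong \<delta> \<alpha> (f \<circ>\<^sub>e EId a) f a b"
| comp_add_left: "\<lbrakk>typed f a b; typed g b c; typed g' b c\<rbrakk> \<Longrightarrow>
    T_cong \<delta> \<alpha> ((g +\<^sub>e g') \<circ>\<^sub>e f) ((g \<circ>\<^sub>e f) +\<^sub>e (g' \<circ>\<^sub>e f)) a c"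
| comp_add_right: "\<lbrakk>typed f a b; typed f' a b; typed g b c\<rbrakk> \<Longrightarrow>
    T_cong \<delta> \<alpha> (g \<circ>\<^sub>e (f +\<^sub>e f')) ((g \<circ>\<^sub>e f) +\<^sub>e (g \<circ>\<^sub>e f')) a c"
| comp_scale_left: "\<lbrakk>typed f a b; typed g b c\<rbrakk> \<Longrightarrow>
    T_cong \<delta> \<alpha> ((r *\<^sub>e g) \<circ>\<^sub>e f) (r *\<^sub>e (g \<circ>\<^sub>e f)) a c"
| comp_scale_right: "\<lbrakk>typed f a b; typed g b c\<rbrakk> \<Longrightarrow>
    T_cong \<delta> \<alpha> (g \<circ>\<^sub>e (r *\<^sub>e f)) (r *\<^sub>e (g \<circ>\<^sub>e f)) a c"
| ten_assoc: "\<lbrakk>typed f a b; typed g a' b'; typed h a'' b''\<rbrakk> \<Longrightarrow>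
    T_cong \<delta> \<alpha> (f \<otimes>\<^sub>e g \<otimes>\<^sub>e h) (f \<otimes>\<^sub>e (g \<otimes>\<^sub>e h)) (a + a' + a'') (b + b' + b'')"
| ten_unit_left: "typed f a b \<Longrightarrow> T_cong \<delta> \<alpha> (EId 0 \<otimes>\<^sub>e f) f a b"
| ten_unit_right: "typed f a b \<Longrightarrow> T_cong \<delta> \<alpha> (f \<otimes>\<^sub>e EId 0) f a b"
| ten_id: "T_cong \<delta> \<alpha> (EId a \<otimes>\<^sub>e EId b) (EId (a + b)) (a + b) (a + b)"
| interchange: "\<lbrakk>typed f a b; typed f' b c; typed g a' b'; typed g' b' c'\<rbrakk> \<Longrightarrow>
    T_cong \<delta> \<alpha> ((f' \<otimes>\<^sub>e g') \<circ>\<^sub>e (f \<otimes>\<^sub>e g)) ((f' \<circ>\<^sub>e f) \<otimes>\<^sub>e (g' \<circ>\<^sub>e g)) (a + a') (c + c')"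
| ten_add_left: "\<lbrakk>typed f a b; typed f' a b; typed g c d\<rbrakk> \<Longrightarrow>
    T_cong \<delta> \<alpha> ((f +\<^sub>e f') \<otimes>\<^sub>e g) ((f \<otimes>\<^sub>e g) +\<^sub>e (f' \<otimes>\<^sub>e g)) (a + c) (b + d)"
| ten_add_right: "\<lbrakk>typed f a b; typed g c d; typed g' c d\<rbrakk> \<Longrightarrow>
    T_cong \<delta> \<alpha> (f \<otimes>\<^sub>e (g +\<^sub>e g')) ((f \<otimes>\<^sub>e g) +\<^sub>e (f \<otimes>\<^sub>e g')) (a + c) (b + d)"
| ten_scale_left: "\<lbrakk>typed f a b; typed g c d\<rbrakk> \<Longrightarrow>
    T_cong \<delta> \<alpha> ((r *\<^sub>e f) \<otimes>\<^sub>e g) (r *\<^sub>e (f \<otimes>\<^sub>e g)) (a + c) (b + d)"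
| ten_scale_right: "\<lbrakk>typed f a b; typed g c d\<rbrakk> \<Longrightarrow>
    T_cong \<delta> \<alpha> (f \<otimes>\<^sub>e (r *\<^sub>e g)) (r *\<^sub>e (f \<otimes>\<^sub>e g)) (a + c) (b + d)"

definition T_class :: "'k::field \<Rightarrow> 'k \<Rightarrow> nat \<Rightarrow> nat \<Rightarrow> 'k expr \<Rightarrow> 'k expr set" where
  "T_class \<delta> \<alpha> a b f = {g. T_cong \<delta> \<alpha> f g a b}"

definition T_hom :: "'k::field \<Rightarrow> 'k \<Rightarrow> nat \<Rightarrow> nat \<Rightarrow> ('k, 'k expr set) module" where
  "T_hom \<delta> \<alpha> a b =
     \<lparr>carrier = T_class \<delta> \<alpha> a b ` {f. typed f a b}, mult = undefined, one = undefined,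
      zero = T_class \<delta> \<alpha> a b (EZero a b),
      add = (\<lambda>F G. \<Union>f\<in>F. \<Union>g\<in>G. T_class \<delta> \<alpha> a b (f +\<^sub>e g)),
      smult = (\<lambda>r F. \<Union>f\<in>F. T_class \<delta> \<alpha> a b (r *\<^sub>e f))\<rparr>"

definition T_cat :: "'k::field \<Rightarrow> 'k \<Rightarrow> (nat, 'k expr set, 'k) lin_moncat" where
  "T_cat \<delta> \<alpha> =
     \<lparr>Hom = T_hom \<delta> \<alpha>,
      Comp = (\<lambda>a b c G F. \<Union>g\<in>G. \<Union>f\<in>F. T_class \<delta> \<alpha> a c (g \<circ>\<^sub>e f)),
      Idn = (\<lambda>a. T_class \<delta> \<alpha> a a (EId a)),
      TenOb = (+),
      UnitOb = 0,
      Ten = (\<lambda>a b c d F G. \<Union>f\<in>F. \<Union>g\<in>G. T_class \<delta> \<alpha> (a + c) (b + d) (f \<otimes>\<^sub>e g))\<rparr>"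

lemma T_cong_typed:
  assumes "T_cong \<delta> \<alpha> f g a b"
  shows "typed f a b \<and> typed g a b"
  using assms
proof induction
  case (rel f g a b)
  note T = typed.intros
  have s1: "typed (GenS \<otimes>\<^sub>e \<one>\<^sub>e) 3 3" using T(7)[OF T(2) T(5)[of 1]] by (simp del: One_nat_def)
  have s2: "typed (\<one>\<^sub>e \<otimes>\<^sub>e GenS) 3 3" using T(7)[OF T(5)[of 1] T(2)] by (simp del: One_nat_def)
  have m1: "typed (GenM \<otimes>\<^sub>e \<one>\<^sub>e) 3 2" using T(7)[OF T(1) T(5)[of 1]] by (simp del: One_nat_def)
  have m2: "typed (\<one>\<^sub>e \<otimes>\<^sub>e GenM) 3 2" using T(7)[OF T(5)[of 1] T(1)] by (simp del: One_nat_def)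
  have e1: "typed (GenEta \<otimes>\<^sub>e \<one>\<^sub>e) 1 3" using T(7)[OF T(3) T(5)[of 1]] by (simp del: One_nat_def)
  have e2: "typed (\<one>\<^sub>e \<otimes>\<^sub>e GenEta) 1 3" using T(7)[OF T(5)[of 1] T(3)] by (simp del: One_nat_def)
  have p1: "typed (GenEps \<otimes>\<^sub>e \<one>\<^sub>e) 3 1" using T(7)[OF T(4) T(5)[of 1]] by (simp del: One_nat_def)
  have p2: "typed (\<one>\<^sub>e \<otimes>\<^sub>e GenEps) 3 1" using T(7)[OF T(5)[of 1] T(4)] by (simp del: One_nat_def)
  have i: "typed (\<one>\<^sub>e \<otimes>\<^sub>e \<one>\<^sub>e) 2 2" using T(7)[OF T(5) T(5), of 1 1] by (simp del: One_nat_def)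
  have sg: "typed sigma 1 2" unfolding sigma_def by (rule T(6)[OF e1 m2])
  have sg1: "typed (sigma \<otimes>\<^sub>e \<one>\<^sub>e) 2 3" using T(7)[OF sg T(5)[of 1]] by (simp del: One_nat_def)
  have sg2: "typed (\<one>\<^sub>e \<otimes>\<^sub>e sigma) 2 3" using T(7)[OF T(5)[of 1] sg] by (simp del: One_nat_def)
  show ?case using rel
    by cases (auto simp del: One_nat_def intro: T s1 s2 m1 m2 e1 e2 p1 p2 i sg sg1 sg2)
next
  case (add_neg f a b) then show ?case by (auto intro: typed.intros)
next
  case (ten_assoc f a b g a' b' h a'' b'')
  have "typed (f \<otimes>\<^sub>e (g \<otimes>\<^sub>e h)) (a + (a' + a'')) (b + (b' + b''))"
    using ten_assoc by (intro typed.intros)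
  moreover have "typed (f \<otimes>\<^sub>e g \<otimes>\<^sub>e h) (a + a' + a'') (b + b' + b'')"
    using ten_assoc by (intro typed.intros)
  ultimately show ?case by (simp add: add.assoc)
next
  case (ten_unit_left f a b)
  then show ?case using typed.intros(7)[OF typed.intros(5)[of 0]] by fastforce
next
  case (ten_unit_right f a b)
  then show ?case using typed.intros(7)[OF _ typed.intros(5)[of 0]] by fastforce
qed (auto intro: typed.intros)

lemma mem_T_class: "typed f a b \<Longrightarrow> f \<in> T_class \<delta> \<alpha> a b f"
  by (simp add: T_class_def T_cong.refl)

lemma T_class_eq: "T_cong \<delta> \<alpha> f g a b \<Longrightarrow> T_class \<delta> \<alpha> a b f = T_class \<delta> \<alpha> a b g"
  unfolding T_class_def by (auto intro: T_cong.sym T_cong.trans)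

lemma UN_T_class:
  assumes "typed f a b" "\<And>f'. T_cong \<delta> \<alpha> f f' a b \<Longrightarrow> T_cong \<delta> \<alpha> (h f) (h f') c d"
  shows "(\<Union>f'\<in>T_class \<delta> \<alpha> a b f. T_class \<delta> \<alpha> c d (h f')) = T_class \<delta> \<alpha> c d (h f)"
proof -
  have "T_class \<delta> \<alpha> c d (h f') = T_class \<delta> \<alpha> c d (h f)" if "f' \<in> T_class \<delta> \<alpha> a b f" for f'
    using that T_class_eq[OF assms(2)] by (auto simp: T_class_def)
  then show ?thesis using mem_T_class[OF assms(1)] by blast
qed

lemma UN2_T_class:
  assumes "typed f a b" "typed g a' b'"
    and "\<And>f' g'. \<lbrakk>T_cong \<delta> \<alpha> f f' a b; T_cong \<delta> \<alpha> g g' a' b'\<rbrakk> \<Longrightarrow> T_cong \<delta> \<alpha> (h f g) (h f' g') c d"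
  shows "(\<Union>f'\<in>T_class \<delta> \<alpha> a b f. \<Union>g'\<in>T_class \<delta> \<alpha> a' b' g. T_class \<delta> \<alpha> c d (h f' g')) =
    T_class \<delta> \<alpha> c d (h f g)"
proof -
  have "T_class \<delta> \<alpha> c d (h f' g') = T_class \<delta> \<alpha> c d (h f g)"
    if "f' \<in> T_class \<delta> \<alpha> a b f" "g' \<in> T_class \<delta> \<alpha> a' b' g" for f' g'
    using that T_class_eq[OF assms(3)] by (auto simp: T_class_def)
  then have "(\<Union>f'\<in>T_class \<delta> \<alpha> a b f. \<Union>g'\<in>T_class \<delta> \<alpha> a' b' g. T_class \<delta> \<alpha> c d (h f' g')) =
      (\<Union>f'\<in>T_class \<delta> \<alpha> a b f. \<Union>g'\<in>T_class \<delta> \<alpha> a' b' g. T_class \<delta> \<alpha> c d (h f g))"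
    by (intro SUP_cong) auto
  then show ?thesis using mem_T_class[OF assms(1), of \<delta> \<alpha>] mem_T_class[OF assms(2), of \<delta> \<alpha>] by auto
qed

lemma T_hom_simps:
  "carrier (T_hom \<delta> \<alpha> a b) = T_class \<delta> \<alpha> a b ` {f. typed f a b}"
  "zero (T_hom \<delta> \<alpha> a b) = T_class \<delta> \<alpha> a b (EZero a b)"
  by (simp_all add: T_hom_def)

lemma T_add:
  "\<lbrakk>typed f a b; typed g a b\<rbrakk> \<Longrightarrow>
    T_class \<delta> \<alpha> a b f \<oplus>\<^bsub>T_hom \<delta> \<alpha> a b\<^esub> T_class \<delta> \<alpha> a b g = T_class \<delta> \<alpha> a b (f +\<^sub>e g)"
  unfolding T_hom_def by (simp, rule UN2_T_class) (auto intro: T_cong.add_cong)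

lemma T_smult:
  "typed f a b \<Longrightarrow> r \<odot>\<^bsub>T_hom \<delta> \<alpha> a b\<^esub> T_class \<delta> \<alpha> a b f = T_class \<delta> \<alpha> a b (r *\<^sub>e f)"
  unfolding T_hom_def by (simp, rule UN_T_class) (auto intro: T_cong.scale_cong)

lemma T_comp:
  "\<lbrakk>typed f a b; typed g b c\<rbrakk> \<Longrightarrow>
    Comp (T_cat \<delta> \<alpha>) a b c (T_class \<delta> \<alpha> b c g) (T_class \<delta> \<alpha> a b f) = T_class \<delta> \<alpha> a c (g \<circ>\<^sub>e f)"
  unfolding T_cat_def by (simp, rule UN2_T_class) (auto intro: T_cong.comp_cong)

lemma T_ten:
  "\<lbrakk>typed f a b; typed g c d\<rbrakk> \<Longrightarrow>
    Ten (T_cat \<delta> \<alpha>) a b c d (T_class \<delta> \<alpha> a b f) (T_class \<delta> \<alpha> c d g) =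
      T_class \<delta> \<alpha> (a + c) (b + d) (f \<otimes>\<^sub>e g)"
  unfolding T_cat_def by (simp, rule UN2_T_class) (auto intro: T_cong.ten_cong)

lemma T_cat_simps:
  "Hom (T_cat \<delta> \<alpha>) = T_hom \<delta> \<alpha>" "Idn (T_cat \<delta> \<alpha>) a = T_class \<delta> \<alpha> a a (EId a)"
  "TenOb (T_cat \<delta> \<alpha>) = (+)" "UnitOb (T_cat \<delta> \<alpha>) = 0"
  by (simp_all add: T_cat_def)

lemma T_hom_vectorspace: "vectorspace class_ring (T_hom \<delta> \<alpha> a b)"
proof -
  note S = T_hom_simps T_add T_smult typed.intros
  have "abelian_group (T_hom \<delta> \<alpha> a b)"
  proof (rule abelian_groupI)
    fix x assume "x \<in> carrier (T_hom \<delta> \<alpha> a b)"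
    then obtain f where f: "x = T_class \<delta> \<alpha> a b f" "typed f a b" by (auto simp: S)
    have "T_class \<delta> \<alpha> a b ((- 1) *\<^sub>e f) \<oplus>\<^bsub>T_hom \<delta> \<alpha> a b\<^esub> x = \<zero>\<^bsub>T_hom \<delta> \<alpha> a b\<^esub>"
      using f by (simp add: S T_class_eq[OF T_cong.add_neg])
    then show "\<exists>y\<in>carrier (T_hom \<delta> \<alpha> a b). y \<oplus>\<^bsub>T_hom \<delta> \<alpha> a b\<^esub> x = \<zero>\<^bsub>T_hom \<delta> \<alpha> a b\<^esub>"
      using f by (intro bexI[of _ "T_class \<delta> \<alpha> a b ((- 1) *\<^sub>e f)"]) (auto simp: S)
  next
    fix x y assume "x \<in> carrier (T_hom \<delta> \<alpha> a b)" "y \<in> carrier (T_hom \<delta> \<alpha> a b)"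
    then show "x \<oplus>\<^bsub>T_hom \<delta> \<alpha> a b\<^esub> y = y \<oplus>\<^bsub>T_hom \<delta> \<alpha> a b\<^esub> x"
      by (auto simp: S T_class_eq[OF T_cong.add_comm])
  qed (auto simp: S T_class_eq[OF T_cong.add_assoc] T_class_eq[OF T_cong.add_zero])
  moreover have "cring (class_ring :: 'a ring)" "field (class_ring :: 'a ring)"
    by unfold_locales
  ultimately have "module class_ring (T_hom \<delta> \<alpha> a b)"
    by (intro moduleI) (auto simp: S T_class_eq[OF T_cong.scale_add] T_class_eq[OF T_cong.add_scale]
        T_class_eq[OF T_cong.scale_scale] T_class_eq[OF T_cong.one_scale])
  then show ?thesis
    by (intro vectorspace.intro) (use \<open>field class_ring\<close> in auto)
qed

theorem T_cat_strict_linear_monoidal: "strict_linear_monoidal_category (T_cat \<delta> \<alpha>)"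
proof -
  note S = T_cat_simps T_hom_simps T_add T_smult T_comp T_ten typed.intros
  show ?thesis
  proof (rule strict_linear_monoidal_category.intro)
    fix a b :: nat
    show "vectorspace class_ring (Hom (T_cat \<delta> \<alpha>) a b)"
      by (simp add: T_cat_simps T_hom_vectorspace)
  qed (auto simp: S add.assoc T_class_eq[OF T_cong.comp_assoc] T_class_eq[OF T_cong.id_left]
      T_class_eq[OF T_cong.id_right] T_class_eq[OF T_cong.comp_add_left]
      T_class_eq[OF T_cong.comp_add_right] T_class_eq[OF T_cong.comp_scale_left]
      T_class_eq[OF T_cong.comp_scale_right] T_class_eq[OF T_cong.ten_id]
      T_class_eq[OF T_cong.interchange] T_class_eq[OF T_cong.ten_assoc, unfolded add.assoc]
      T_class_eq[OF T_cong.ten_unit_left] T_class_eq[OF T_cong.ten_unit_right]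
      T_class_eq[OF T_cong.ten_add_left] T_class_eq[OF T_cong.ten_add_right]
      T_class_eq[OF T_cong.ten_scale_left] T_class_eq[OF T_cong.ten_scale_right])
qed

end

theory Submission
  imports Defs
begin

text \<open>
  Let \<open>u = \<eta> \<circ> \<epsilon>\<close> (called \<open>cupcap\<close>) and suppose that the ideal does not
  contain the identity of \<open>X \<otimes> X\<close>. The point is that the classes
  of \<open>1\<close>, \<open>s\<close> and \<open>u\<close> in the quotient of \<open>End(X \<otimes> X)\<close> are linearly independent
  (\<open>comb_independent\<close>), so that the quotient has dimension at least three; if the ideal does
  contain the identity, the quotient is zero. In neither case is the dimension 1 or 2.
  
  Independence of \<open>1\<close> and \<open>s\<close> (\<open>id_s_independent\<close>) holds because \<open>m s = - m\<close> and
  \<open>\<epsilon> s = \<epsilon>\<close>: composing \<open>p 1 + q s = 0\<close> with \<open>m\<close> and with \<open>\<epsilon>\<close> gives \<open>(p - q) m = 0\<close> and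
  \<open>(p + q) \<epsilon> = 0\<close>, while \<open>m\<close> and \<open>\<epsilon>\<close> are non-zero since \<open>m \<sigma> = \<alpha> 1\<close> with \<open>\<alpha> \<noteq> 0\<close> and
  since \<open>\<epsilon>\<close> occurs in the zigzag relation. Characteristic different from 2 then forces \<open>p = q = 0\<close>.
  
  For all three elements, the set of triples \<open>(p, q, r)\<close> with \<open>p 1 + q s + r u = 0\<close> has two
  symmetries. Composition with \<open>s\<close> exchanges \<open>1\<close> and \<open>s\<close> and fixes \<open>u\<close>
  (\<open>null_comb_swap_id_s\<close>). The quarter turn of diagrams exchanges \<open>1\<close> and \<open>u\<close> and fixes \<open>s\<close>
  (\<open>null_comb_swap_id_cupcap\<close>). Subtracting from a relation its mirror image under either symmetry
  leaves a relation between two of the elements, which the symmetries turn into one between \<open>1\<close>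
  and \<open>s\<close>; it must be trivial, so \<open>p = q = r\<close>. Finally \<open>u (1 + s + u) = (2 + \<delta>) u\<close>, and \<open>u \<noteq> 0\<close>
  because its quarter turn is \<open>1\<close>; hence \<open>\<delta> \<noteq> - 2\<close> gives \<open>p = 0\<close>.
\<close>

section \<open>Calculating with expressions\<close>

text \<open>
  Source and target of a tensor product are sums. Isolating them in equations lets the rule match
  numerals such as 3 by backward resolution, and leaves only arithmetic; \<open>equ_ten\<close>,
  \<open>equ_interchange\<close> and \<open>equ_ten_assoc\<close> have the same form.
\<close>

lemma typed_tenI: "\<lbrakk>typed f a b; typed g c d; m = a + c; n = b + d\<rbrakk> \<Longrightarrow> typed (f \<otimes>\<^sub>e g) m n"
  using typed.intros(7) by simp

lemmas typed_rules = typed.intros(1-6) typed.intros(8-10) typed_tenI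

definition cupcap :: "'k expr" where
  "cupcap = GenEta \<circ>\<^sub>e GenEps"

text \<open>
  The quarter turn \<open>(1 \<otimes> 1 \<otimes> \<epsilon>) (1 \<otimes> f \<otimes> 1) (\<eta> \<otimes> 1 \<otimes> 1)\<close>: the first input of \<open>f\<close> is bent up to an
  output and its second output is bent down to an input. The two upper factors are grouped so that
  for \<open>f = s\<close> the inner one is a side of the relation \<open>(1 \<otimes> \<epsilon>) (s \<otimes> 1) = (\<epsilon> \<otimes> 1) (1 \<otimes> s)\<close>.
\<close>

definition rotate :: "'k expr \<Rightarrow> 'k expr" where
  "rotate f = (\<one>\<^sub>e \<otimes>\<^sub>e ((\<one>\<^sub>e \<otimes>\<^sub>e GenEps) \<circ>\<^sub>e (f \<otimes>\<^sub>e \<one>\<^sub>e))) \<circ>\<^sub>e (GenEta \<otimes>\<^sub>e EId 2)"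

definition comb :: "'k \<Rightarrow> 'k \<Rightarrow> 'k \<Rightarrow> 'k expr" where
  "comb p q r = p *\<^sub>e EId 2 +\<^sub>e (q *\<^sub>e GenS +\<^sub>e r *\<^sub>e cupcap)"

lemma typed_cupcap: "typed cupcap 2 2"
  unfolding cupcap_def by (rule typed_rules | (simp; fail))+

lemma typed_comb: "typed (comb p q r) 2 2"
  unfolding comb_def by (rule typed_rules typed_cupcap | (simp; fail))+

context
  fixes \<delta> \<alpha> :: "'k::field"
begin

abbreviation equ :: "'k expr \<Rightarrow> 'k expr \<Rightarrow> nat \<Rightarrow> nat \<Rightarrow> bool" where
  "equ \<equiv> T_cong \<delta> \<alpha>"

lemmas [trans] = T_cong.trans[of \<delta> \<alpha>]

lemma equ_ten: "\<lbrakk>equ f f' a b; equ g g' c d; m = a + c; n = b + d\<rbrakk> \<Longrightarrow> equ (f \<otimes>\<^sub>e g) (f' \<otimes>\<^sub>e g') m n"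
  using T_cong.ten_cong by simp

lemma equ_comp1: "\<lbrakk>equ g g' b c; typed f a b\<rbrakk> \<Longrightarrow> equ (g \<circ>\<^sub>e f) (g' \<circ>\<^sub>e f) a c"
  and equ_comp2: "\<lbrakk>equ f f' a b; typed g b c\<rbrakk> \<Longrightarrow> equ (g \<circ>\<^sub>e f) (g \<circ>\<^sub>e f') a c"
  by (auto intro: T_cong.comp_cong T_cong.refl)

lemma equ_interchange:
  "\<lbrakk>typed f a b; typed f' b c; typed g a' b'; typed g' b' c'; m = a + a'; n = c + c'\<rbrakk> \<Longrightarrow>
    equ ((f' \<otimes>\<^sub>e g') \<circ>\<^sub>e (f \<otimes>\<^sub>e g)) ((f' \<circ>\<^sub>e f) \<otimes>\<^sub>e (g' \<circ>\<^sub>e g)) m n"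
  using T_cong.interchange by simp

lemma equ_ten_assoc:
  "\<lbrakk>typed f a b; typed g a' b'; typed h a'' b''; m = a + a' + a''; n = b + b' + b''\<rbrakk> \<Longrightarrow>
    equ (f \<otimes>\<^sub>e (g \<otimes>\<^sub>e h)) (f \<otimes>\<^sub>e g \<otimes>\<^sub>e h) m n"
  using T_cong.ten_assoc[THEN T_cong.sym] by simp

lemma equ_id2: "equ (\<one>\<^sub>e \<otimes>\<^sub>e \<one>\<^sub>e) (EId 2) 2 2"
  using T_cong.ten_id[of \<delta> \<alpha> 1 1] by (simp add: numeral_2_eq_2)

text \<open>
  A morphism out of the unit object can be placed above or below whatever stands beside it. For
  \<open>f = \<eta>\<close> this moves diagrams past a cup.
\<close>

lemma ten_as_comp:
  assumes f: "typed f 0 a" and g: "typed g b c"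
  shows "equ ((f \<otimes>\<^sub>e EId c) \<circ>\<^sub>e g) (f \<otimes>\<^sub>e g) b (a + c)"
    and "equ ((EId a \<otimes>\<^sub>e g) \<circ>\<^sub>e (f \<otimes>\<^sub>e EId b)) (f \<otimes>\<^sub>e g) b (a + c)"
proof -
  have "equ ((f \<otimes>\<^sub>e EId c) \<circ>\<^sub>e g) ((f \<otimes>\<^sub>e EId c) \<circ>\<^sub>e (EId 0 \<otimes>\<^sub>e g)) b (a + c)"
    by (rule equ_comp2 T_cong.ten_unit_left[THEN T_cong.sym] typed_rules f g | (simp; fail))+
  also have "equ ((f \<otimes>\<^sub>e EId c) \<circ>\<^sub>e (EId 0 \<otimes>\<^sub>e g)) ((f \<circ>\<^sub>e EId 0) \<otimes>\<^sub>e (EId c \<circ>\<^sub>e g)) b (a + c)"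
    by (rule equ_interchange typed_rules f g | (simp; fail))+
  also have "equ ((f \<circ>\<^sub>e EId 0) \<otimes>\<^sub>e (EId c \<circ>\<^sub>e g)) (f \<otimes>\<^sub>e g) b (a + c)"
    by (rule equ_ten T_cong.id_left T_cong.id_right f g | (simp; fail))+
  finally show "equ ((f \<otimes>\<^sub>e EId c) \<circ>\<^sub>e g) (f \<otimes>\<^sub>e g) b (a + c)" .
  have "equ ((EId a \<otimes>\<^sub>e g) \<circ>\<^sub>e (f \<otimes>\<^sub>e EId b)) ((EId a \<circ>\<^sub>e f) \<otimes>\<^sub>e (g \<circ>\<^sub>e EId b)) b (a + c)"
    by (rule equ_interchange typed_rules f g | (simp; fail))+
  also have "equ ((EId a \<circ>\<^sub>e f) \<otimes>\<^sub>e (g \<circ>\<^sub>e EId b)) (f \<otimes>\<^sub>e g) b (a + c)"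
    by (rule equ_ten T_cong.id_left T_cong.id_right f g | (simp; fail))+
  finally show "equ ((EId a \<otimes>\<^sub>e g) \<circ>\<^sub>e (f \<otimes>\<^sub>e EId b)) (f \<otimes>\<^sub>e g) b (a + c)" .
qed

section \<open>The quarter turn\<close>

text \<open>
  Bending an endomorphism of \<open>X \<otimes> X\<close> with the cap \<open>\<epsilon>\<close> turns \<open>1\<close>, \<open>u\<close> and \<open>s\<close> into the morphisms
  \<open>1 \<otimes> \<epsilon>\<close>, \<open>\<epsilon> \<otimes> 1\<close> and \<open>(\<epsilon> \<otimes> 1) (1 \<otimes> s)\<close> from three strands to one. The next three lemmas bend
  the first strand back with the cup \<open>\<eta>\<close>. Here \<open>\<eta>\<close> and \<open>\<epsilon>\<close> do not meet, so they slide over each other.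
\<close>

lemma unbend_right_cap:
  "equ ((\<one>\<^sub>e \<otimes>\<^sub>e (\<one>\<^sub>e \<otimes>\<^sub>e GenEps)) \<circ>\<^sub>e (GenEta \<otimes>\<^sub>e EId 2)) cupcap 2 2"
proof -
  have "equ (\<one>\<^sub>e \<otimes>\<^sub>e (\<one>\<^sub>e \<otimes>\<^sub>e GenEps)) (\<one>\<^sub>e \<otimes>\<^sub>e \<one>\<^sub>e \<otimes>\<^sub>e GenEps) 4 2"
    by (rule equ_ten_assoc typed_rules | (simp; fail))+
  also have "equ (\<one>\<^sub>e \<otimes>\<^sub>e \<one>\<^sub>e \<otimes>\<^sub>e GenEps) (EId 2 \<otimes>\<^sub>e GenEps) 4 2"
    by (rule equ_ten equ_id2 T_cong.refl typed_rules | (simp; fail))+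
  finally have "equ ((\<one>\<^sub>e \<otimes>\<^sub>e (\<one>\<^sub>e \<otimes>\<^sub>e GenEps)) \<circ>\<^sub>e (GenEta \<otimes>\<^sub>e EId 2))
      ((EId 2 \<otimes>\<^sub>e GenEps) \<circ>\<^sub>e (GenEta \<otimes>\<^sub>e EId 2)) 2 2"
    by - (assumption | rule equ_comp1 typed_rules | (simp; fail))+
  also have "equ ((EId 2 \<otimes>\<^sub>e GenEps) \<circ>\<^sub>e (GenEta \<otimes>\<^sub>e EId 2)) (GenEta \<otimes>\<^sub>e GenEps) 2 2"
    using ten_as_comp(2)[OF typed.intros(3,4)] by simp
  also have "equ (GenEta \<otimes>\<^sub>e GenEps) ((GenEta \<otimes>\<^sub>e EId 0) \<circ>\<^sub>e GenEps) 2 2"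
    using ten_as_comp(1)[OF typed.intros(3,4), THEN T_cong.sym] by simp
  also have "equ ((GenEta \<otimes>\<^sub>e EId 0) \<circ>\<^sub>e GenEps) cupcap 2 2"
    unfolding cupcap_def by (rule equ_comp1 T_cong.ten_unit_right typed_rules | (simp; fail))+
  finally show ?thesis .
qed

text \<open>
  The cap meets the cup in a zigzag, which straightens.
\<close>

lemma unbend_left_cap:
  "equ ((\<one>\<^sub>e \<otimes>\<^sub>e (GenEps \<otimes>\<^sub>e \<one>\<^sub>e)) \<circ>\<^sub>e (GenEta \<otimes>\<^sub>e EId 2)) (EId 2) 2 2"
proof -
  have "equ (GenEta \<otimes>\<^sub>e EId 2) (GenEta \<otimes>\<^sub>e (\<one>\<^sub>e \<otimes>\<^sub>e \<one>\<^sub>e)) 2 4"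
    by (rule equ_ten equ_id2[THEN T_cong.sym] T_cong.refl typed_rules | (simp; fail))+
  also have "equ (GenEta \<otimes>\<^sub>e (\<one>\<^sub>e \<otimes>\<^sub>e \<one>\<^sub>e)) (GenEta \<otimes>\<^sub>e \<one>\<^sub>e \<otimes>\<^sub>e \<one>\<^sub>e) 2 4"
    by (rule equ_ten_assoc typed_rules | (simp; fail))+
  finally have "equ ((\<one>\<^sub>e \<otimes>\<^sub>e (GenEps \<otimes>\<^sub>e \<one>\<^sub>e)) \<circ>\<^sub>e (GenEta \<otimes>\<^sub>e EId 2))
      ((\<one>\<^sub>e \<otimes>\<^sub>e GenEps \<otimes>\<^sub>e \<one>\<^sub>e) \<circ>\<^sub>e (GenEta \<otimes>\<^sub>e \<one>\<^sub>e \<otimes>\<^sub>e \<one>\<^sub>e)) 2 2"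
    by - (assumption | rule T_cong.comp_cong equ_ten_assoc typed_rules | (simp; fail))+
  also have "equ ((\<one>\<^sub>e \<otimes>\<^sub>e GenEps \<otimes>\<^sub>e \<one>\<^sub>e) \<circ>\<^sub>e (GenEta \<otimes>\<^sub>e \<one>\<^sub>e \<otimes>\<^sub>e \<one>\<^sub>e))
      (((\<one>\<^sub>e \<otimes>\<^sub>e GenEps) \<circ>\<^sub>e (GenEta \<otimes>\<^sub>e \<one>\<^sub>e)) \<otimes>\<^sub>e (\<one>\<^sub>e \<circ>\<^sub>e \<one>\<^sub>e)) 2 2"
    by (rule equ_interchange typed_rules | (simp; fail))+
  also have "equ (((\<one>\<^sub>e \<otimes>\<^sub>e GenEps) \<circ>\<^sub>e (GenEta \<otimes>\<^sub>e \<one>\<^sub>e)) \<otimes>\<^sub>e (\<one>\<^sub>e \<circ>\<^sub>e \<one>\<^sub>e)) (\<one>\<^sub>e \<otimes>\<^sub>e \<one>\<^sub>e) 2 2"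
    by (rule equ_ten T_cong.rel[OF T_rel.zigzag_right, THEN T_cong.sym] T_cong.id_left typed_rules | (simp; fail))+
  also note equ_id2
  finally show ?thesis .
qed

text \<open>
  The crossing \<open>s\<close> acts on the two strands that \<open>\<eta>\<close> does not touch; it slides below \<open>\<eta>\<close>, and the zigzag
  of \<open>unbend_left_cap\<close> remains.
\<close>

lemma unbend_slide:
  "equ ((\<one>\<^sub>e \<otimes>\<^sub>e ((GenEps \<otimes>\<^sub>e \<one>\<^sub>e) \<circ>\<^sub>e (\<one>\<^sub>e \<otimes>\<^sub>e GenS))) \<circ>\<^sub>e (GenEta \<otimes>\<^sub>e EId 2)) GenS 2 2"
proof -
  let ?e = "\<one>\<^sub>e \<otimes>\<^sub>e (GenEps \<otimes>\<^sub>e \<one>\<^sub>e)" and ?s = "\<one>\<^sub>e \<otimes>\<^sub>e (\<one>\<^sub>e \<otimes>\<^sub>e GenS)" and ?h = "GenEta \<otimes>\<^sub>e EId 2"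
  have e: "typed ?e 4 2" and s: "typed ?s 4 4" and h: "typed ?h 2 4"
    by (rule typed_rules | (simp; fail))+
  have "equ (\<one>\<^sub>e \<otimes>\<^sub>e ((GenEps \<otimes>\<^sub>e \<one>\<^sub>e) \<circ>\<^sub>e (\<one>\<^sub>e \<otimes>\<^sub>e GenS)))
      ((\<one>\<^sub>e \<circ>\<^sub>e \<one>\<^sub>e) \<otimes>\<^sub>e ((GenEps \<otimes>\<^sub>e \<one>\<^sub>e) \<circ>\<^sub>e (\<one>\<^sub>e \<otimes>\<^sub>e GenS))) 4 2"
    by (rule equ_ten T_cong.id_left[THEN T_cong.sym] T_cong.refl typed_rules | (simp; fail))+
  also have "equ ((\<one>\<^sub>e \<circ>\<^sub>e \<one>\<^sub>e) \<otimes>\<^sub>e ((GenEps \<otimes>\<^sub>e \<one>\<^sub>e) \<circ>\<^sub>e (\<one>\<^sub>e \<otimes>\<^sub>e GenS))) (?e \<circ>\<^sub>e ?s) 4 2"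
    by (rule equ_interchange[THEN T_cong.sym] typed_rules | (simp; fail))+
  finally have "equ ((\<one>\<^sub>e \<otimes>\<^sub>e ((GenEps \<otimes>\<^sub>e \<one>\<^sub>e) \<circ>\<^sub>e (\<one>\<^sub>e \<otimes>\<^sub>e GenS))) \<circ>\<^sub>e ?h) (?e \<circ>\<^sub>e ?s \<circ>\<^sub>e ?h) 2 2"
    by - (assumption | rule equ_comp1 h | (simp; fail))+
  also have "equ (?e \<circ>\<^sub>e ?s \<circ>\<^sub>e ?h) (?e \<circ>\<^sub>e (?s \<circ>\<^sub>e ?h)) 2 2"
    by (rule T_cong.comp_assoc e s h | (simp; fail))+
  also have "equ (?e \<circ>\<^sub>e (?s \<circ>\<^sub>e ?h)) (?e \<circ>\<^sub>e (?h \<circ>\<^sub>e GenS)) 2 2"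
  proof (rule equ_comp2[OF _ e])
    have "equ ?s (\<one>\<^sub>e \<otimes>\<^sub>e \<one>\<^sub>e \<otimes>\<^sub>e GenS) 4 4"
      by (rule equ_ten_assoc typed_rules | (simp; fail))+
    also have "equ (\<one>\<^sub>e \<otimes>\<^sub>e \<one>\<^sub>e \<otimes>\<^sub>e GenS) (EId 2 \<otimes>\<^sub>e GenS) 4 4"
      by (rule equ_ten equ_id2 T_cong.refl typed_rules | (simp; fail))+
    finally have "equ (?s \<circ>\<^sub>e ?h) ((EId 2 \<otimes>\<^sub>e GenS) \<circ>\<^sub>e ?h) 2 4"
      by - (assumption | rule equ_comp1 h | (simp; fail))+
    also have "equ ((EId 2 \<otimes>\<^sub>e GenS) \<circ>\<^sub>e ?h) (GenEta \<otimes>\<^sub>e GenS) 2 4"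
      using ten_as_comp(2)[OF typed.intros(3,2)] by simp
    also have "equ (GenEta \<otimes>\<^sub>e GenS) (?h \<circ>\<^sub>e GenS) 2 4"
      using ten_as_comp(1)[OF typed.intros(3,2), THEN T_cong.sym] by simp
    finally show "equ (?s \<circ>\<^sub>e ?h) (?h \<circ>\<^sub>e GenS) 2 4" .
  qed
  also have "equ (?e \<circ>\<^sub>e (?h \<circ>\<^sub>e GenS)) (?e \<circ>\<^sub>e ?h \<circ>\<^sub>e GenS) 2 2"
    by (rule T_cong.comp_assoc[THEN T_cong.sym] e h typed_rules | (simp; fail))+
  also have "equ (?e \<circ>\<^sub>e ?h \<circ>\<^sub>e GenS) (EId 2 \<circ>\<^sub>e GenS) 2 2"
    by (rule equ_comp1 unbend_left_cap typed_rules | (simp; fail))+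
  also have "equ (EId 2 \<circ>\<^sub>e GenS) GenS 2 2"
    by (rule T_cong.id_left typed_rules | (simp; fail))+
  finally show ?thesis .
qed

lemma rotate_equI:
  assumes "equ ((\<one>\<^sub>e \<otimes>\<^sub>e GenEps) \<circ>\<^sub>e (f \<otimes>\<^sub>e \<one>\<^sub>e)) g 3 1"
    and "equ ((\<one>\<^sub>e \<otimes>\<^sub>e g) \<circ>\<^sub>e (GenEta \<otimes>\<^sub>e EId 2)) h 2 2"
  shows "equ (rotate f) h 2 2"
proof -
  have "equ (rotate f) ((\<one>\<^sub>e \<otimes>\<^sub>e g) \<circ>\<^sub>e (GenEta \<otimes>\<^sub>e EId 2)) 2 2"
    unfolding rotate_def
    by (rule equ_comp1 equ_ten assms(1) T_cong.refl typed_rules | (simp; fail))+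
  then show ?thesis using assms(2) by (rule T_cong.trans)
qed

lemma rotate_id: "equ (rotate (EId 2)) cupcap 2 2"
proof (rule rotate_equI[OF _ unbend_right_cap])
  have "equ (EId 2 \<otimes>\<^sub>e \<one>\<^sub>e) (EId 3) 3 3"
    using T_cong.ten_id[of \<delta> \<alpha> 2 1] by (simp add: numeral_3_eq_3 numeral_2_eq_2)
  then have "equ ((\<one>\<^sub>e \<otimes>\<^sub>e GenEps) \<circ>\<^sub>e (EId 2 \<otimes>\<^sub>e \<one>\<^sub>e)) ((\<one>\<^sub>e \<otimes>\<^sub>e GenEps) \<circ>\<^sub>e EId 3) 3 1"
    by - (assumption | rule equ_comp2 typed_rules | (simp; fail))+
  also have "equ ((\<one>\<^sub>e \<otimes>\<^sub>e GenEps) \<circ>\<^sub>e EId 3) (\<one>\<^sub>e \<otimes>\<^sub>e GenEps) 3 1"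
    by (rule T_cong.id_right typed_rules | (simp; fail))+
  finally show "equ ((\<one>\<^sub>e \<otimes>\<^sub>e GenEps) \<circ>\<^sub>e (EId 2 \<otimes>\<^sub>e \<one>\<^sub>e)) (\<one>\<^sub>e \<otimes>\<^sub>e GenEps) 3 1" .
qed

text \<open>
  The sliding relation moves \<open>s\<close> from the right cap to the left cap, which makes \<open>s\<close> invariant under
  the quarter turn.
\<close>

lemma rotate_s: "equ (rotate GenS) GenS 2 2"
  by (rule rotate_equI[OF T_cong.rel[OF T_rel.eps_s_slide] unbend_slide])

lemma rotate_cupcap: "equ (rotate cupcap) (EId 2) 2 2"
proof (rule rotate_equI[OF _ unbend_left_cap])
  let ?e = "\<one>\<^sub>e \<otimes>\<^sub>e GenEps" and ?h = "GenEta \<otimes>\<^sub>e \<one>\<^sub>e" and ?c = "GenEps \<otimes>\<^sub>e \<one>\<^sub>e"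
  have e: "typed ?e 3 1" and h: "typed ?h 1 3" and c: "typed ?c 3 1"
    by (rule typed_rules | (simp; fail))+
  have "equ (cupcap \<otimes>\<^sub>e \<one>\<^sub>e) (cupcap \<otimes>\<^sub>e (\<one>\<^sub>e \<circ>\<^sub>e \<one>\<^sub>e)) 3 3"
    by (rule equ_ten T_cong.id_left[THEN T_cong.sym] T_cong.refl typed_cupcap typed_rules | (simp; fail))+
  also have "equ (cupcap \<otimes>\<^sub>e (\<one>\<^sub>e \<circ>\<^sub>e \<one>\<^sub>e)) (?h \<circ>\<^sub>e ?c) 3 3"
    unfolding cupcap_def by (rule equ_interchange[THEN T_cong.sym] typed_rules | (simp; fail))+
  finally have "equ (?e \<circ>\<^sub>e (cupcap \<otimes>\<^sub>e \<one>\<^sub>e)) (?e \<circ>\<^sub>e (?h \<circ>\<^sub>e ?c)) 3 1"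
    by - (assumption | rule equ_comp2 e | (simp; fail))+
  also have "equ (?e \<circ>\<^sub>e (?h \<circ>\<^sub>e ?c)) (?e \<circ>\<^sub>e ?h \<circ>\<^sub>e ?c) 3 1"
    by (rule T_cong.comp_assoc[THEN T_cong.sym] e h c | (simp; fail))+
  also have "equ (?e \<circ>\<^sub>e ?h \<circ>\<^sub>e ?c) (\<one>\<^sub>e \<circ>\<^sub>e ?c) 3 1"
    by (rule equ_comp1 T_cong.rel[OF T_rel.zigzag_right, THEN T_cong.sym] c | (simp; fail))+
  also have "equ (\<one>\<^sub>e \<circ>\<^sub>e ?c) ?c 3 1"
    by (rule T_cong.id_left c | (simp; fail))+
  finally show "equ (?e \<circ>\<^sub>e (cupcap \<otimes>\<^sub>e \<one>\<^sub>e)) ?c 3 1" .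
qed

lemma rotate_add:
  assumes f: "typed f 2 2" and g: "typed g 2 2"
  shows "equ (rotate (f +\<^sub>e g)) (rotate f +\<^sub>e rotate g) 2 2"
proof -
  let ?bend = "\<lambda>f. (\<one>\<^sub>e \<otimes>\<^sub>e GenEps) \<circ>\<^sub>e (f \<otimes>\<^sub>e \<one>\<^sub>e)" and ?h = "GenEta \<otimes>\<^sub>e EId 2"
  have e: "typed (\<one>\<^sub>e \<otimes>\<^sub>e GenEps) 3 1" and h: "typed ?h 2 4"
    by (rule typed_rules | (simp; fail))+
  have b: "typed (?bend f) 3 1" "typed (?bend g) 3 1"
    by (rule typed_rules f g | (simp; fail))+
  have "equ (?bend (f +\<^sub>e g)) ((\<one>\<^sub>e \<otimes>\<^sub>e GenEps) \<circ>\<^sub>e (f \<otimes>\<^sub>e \<one>\<^sub>e +\<^sub>e g \<otimes>\<^sub>e \<one>\<^sub>e)) 3 1"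
    using T_cong.ten_add_left[OF f g typed.intros(5)[of 1], of \<delta> \<alpha>] by - (rule equ_comp2[OF _ e], simp)
  also have "equ ((\<one>\<^sub>e \<otimes>\<^sub>e GenEps) \<circ>\<^sub>e (f \<otimes>\<^sub>e \<one>\<^sub>e +\<^sub>e g \<otimes>\<^sub>e \<one>\<^sub>e)) (?bend f +\<^sub>e ?bend g) 3 1"
    by (rule T_cong.comp_add_right e typed_tenI[OF f] typed_tenI[OF g] typed.intros(5) | (simp; fail))+
  finally have "equ (\<one>\<^sub>e \<otimes>\<^sub>e ?bend (f +\<^sub>e g)) (\<one>\<^sub>e \<otimes>\<^sub>e (?bend f +\<^sub>e ?bend g)) 4 2"
    by - (assumption | rule equ_ten T_cong.refl typed_rules | (simp; fail))+
  also have "equ (\<one>\<^sub>e \<otimes>\<^sub>e (?bend f +\<^sub>e ?bend g)) (\<one>\<^sub>e \<otimes>\<^sub>e ?bend f +\<^sub>e \<one>\<^sub>e \<otimes>\<^sub>e ?bend g) 4 2"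
    using T_cong.ten_add_right[OF typed.intros(5)[of 1] b, of \<delta> \<alpha>] by (simp del: One_nat_def)
  finally have "equ (rotate (f +\<^sub>e g)) ((\<one>\<^sub>e \<otimes>\<^sub>e ?bend f +\<^sub>e \<one>\<^sub>e \<otimes>\<^sub>e ?bend g) \<circ>\<^sub>e ?h) 2 2"
    unfolding rotate_def by - (assumption | rule equ_comp1 h | (simp; fail))+
  also have "equ ((\<one>\<^sub>e \<otimes>\<^sub>e ?bend f +\<^sub>e \<one>\<^sub>e \<otimes>\<^sub>e ?bend g) \<circ>\<^sub>e ?h) (rotate f +\<^sub>e rotate g) 2 2"
    unfolding rotate_def
    by (rule T_cong.comp_add_left h typed_tenI[OF typed.intros(5) b(1)]
        typed_tenI[OF typed.intros(5) b(2)] | (simp; fail))+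
  finally show ?thesis .
qed

lemma rotate_scale:
  assumes f: "typed f 2 2"
  shows "equ (rotate (r *\<^sub>e f)) (r *\<^sub>e rotate f) 2 2"
proof -
  let ?bend = "\<lambda>f. (\<one>\<^sub>e \<otimes>\<^sub>e GenEps) \<circ>\<^sub>e (f \<otimes>\<^sub>e \<one>\<^sub>e)" and ?h = "GenEta \<otimes>\<^sub>e EId 2"
  have e: "typed (\<one>\<^sub>e \<otimes>\<^sub>e GenEps) 3 1" and h: "typed ?h 2 4"
    by (rule typed_rules | (simp; fail))+
  have b: "typed (?bend f) 3 1"
    by (rule typed_rules f | (simp; fail))+
  have "equ (?bend (r *\<^sub>e f)) ((\<one>\<^sub>e \<otimes>\<^sub>e GenEps) \<circ>\<^sub>e (r *\<^sub>e (f \<otimes>\<^sub>e \<one>\<^sub>e))) 3 1"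
    using T_cong.ten_scale_left[OF f typed.intros(5)[of 1], of \<delta> \<alpha>] by - (rule equ_comp2[OF _ e], simp)
  also have "equ ((\<one>\<^sub>e \<otimes>\<^sub>e GenEps) \<circ>\<^sub>e (r *\<^sub>e (f \<otimes>\<^sub>e \<one>\<^sub>e))) (r *\<^sub>e ?bend f) 3 1"
    by (rule T_cong.comp_scale_right e typed_tenI[OF f] typed.intros(5) | (simp; fail))+
  finally have "equ (\<one>\<^sub>e \<otimes>\<^sub>e ?bend (r *\<^sub>e f)) (\<one>\<^sub>e \<otimes>\<^sub>e (r *\<^sub>e ?bend f)) 4 2"
    by - (assumption | rule equ_ten T_cong.refl typed_rules | (simp; fail))+
  also have "equ (\<one>\<^sub>e \<otimes>\<^sub>e (r *\<^sub>e ?bend f)) (r *\<^sub>e (\<one>\<^sub>e \<otimes>\<^sub>e ?bend f)) 4 2"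
    using T_cong.ten_scale_right[OF typed.intros(5)[of 1] b, of \<delta> \<alpha>] by (simp del: One_nat_def)
  finally have "equ (rotate (r *\<^sub>e f)) ((r *\<^sub>e (\<one>\<^sub>e \<otimes>\<^sub>e ?bend f)) \<circ>\<^sub>e ?h) 2 2"
    unfolding rotate_def by - (assumption | rule equ_comp1 h | (simp; fail))+
  also have "equ ((r *\<^sub>e (\<one>\<^sub>e \<otimes>\<^sub>e ?bend f)) \<circ>\<^sub>e ?h) (r *\<^sub>e rotate f) 2 2"
    unfolding rotate_def
    by (rule T_cong.comp_scale_left h typed_tenI[OF typed.intros(5) b] | (simp; fail))+
  finally show ?thesis .
qed

section \<open>Linear combinations of the identity, the crossing and the cup-cap\<close>

text \<open>
  A common form for composing with a fixed morphism and for rotating: \<open>F\<close> need only be linear up to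
  congruence.
\<close>

lemma linear_image_comb:
  assumes add: "\<And>f g. \<lbrakk>typed f 2 2; typed g 2 2\<rbrakk> \<Longrightarrow> equ (F (f +\<^sub>e g)) (F f +\<^sub>e F g) a b"
    and scale: "\<And>f r. typed f 2 2 \<Longrightarrow> equ (F (r *\<^sub>e f)) (r *\<^sub>e F f) a b"
    and basis: "equ (F (EId 2)) x a b" "equ (F GenS) y a b" "equ (F cupcap) z a b"
  shows "equ (F (comb p q r)) (p *\<^sub>e x +\<^sub>e (q *\<^sub>e y +\<^sub>e r *\<^sub>e z)) a b"
proof -
  have scaled: "equ (F (c *\<^sub>e f)) (c *\<^sub>e f') a b" if "typed f 2 2" "equ (F f) f' a b" for c f f'
    using scale[OF that(1)] T_cong.scale_cong[OF that(2)] by (rule T_cong.trans)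
  have "equ (F (q *\<^sub>e GenS +\<^sub>e r *\<^sub>e cupcap)) (F (q *\<^sub>e GenS) +\<^sub>e F (r *\<^sub>e cupcap)) a b"
    by (rule add typed_rules typed_cupcap | (simp; fail))+
  also have "equ (F (q *\<^sub>e GenS) +\<^sub>e F (r *\<^sub>e cupcap)) (q *\<^sub>e y +\<^sub>e r *\<^sub>e z) a b"
    by (rule T_cong.add_cong scaled basis typed_rules typed_cupcap | (simp; fail))+
  finally have tail: "equ (F (q *\<^sub>e GenS +\<^sub>e r *\<^sub>e cupcap)) (q *\<^sub>e y +\<^sub>e r *\<^sub>e z) a b" .
  have "equ (F (comb p q r)) (F (p *\<^sub>e EId 2) +\<^sub>e F (q *\<^sub>e GenS +\<^sub>e r *\<^sub>e cupcap)) a b"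
    unfolding comb_def by (rule add typed_rules typed_cupcap | (simp; fail))+
  also have "equ (F (p *\<^sub>e EId 2) +\<^sub>e F (q *\<^sub>e GenS +\<^sub>e r *\<^sub>e cupcap)) (p *\<^sub>e x +\<^sub>e (q *\<^sub>e y +\<^sub>e r *\<^sub>e z)) a b"
    by (rule T_cong.add_cong scaled tail basis typed_rules | (simp; fail))+
  finally show ?thesis .
qed

lemma comp_left_comb:
  assumes h: "typed h 2 c"
    and basis: "equ h x 2 c" "equ (h \<circ>\<^sub>e GenS) y 2 c" "equ (h \<circ>\<^sub>e cupcap) z 2 c"
  shows "equ (h \<circ>\<^sub>e comb p q r) (p *\<^sub>e x +\<^sub>e (q *\<^sub>e y +\<^sub>e r *\<^sub>e z)) 2 c"
  by (rule linear_image_comb[where F = "\<lambda>f. h \<circ>\<^sub>e f"])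
    (rule T_cong.comp_add_right T_cong.comp_scale_right
        T_cong.trans[OF T_cong.id_right[OF h] basis(1)] basis(2,3) h | assumption)+

lemma class_add: "\<lbrakk>typed f a b; typed g a b\<rbrakk> \<Longrightarrow>
    T_class \<delta> \<alpha> a b (f +\<^sub>e g) = T_class \<delta> \<alpha> a b f \<oplus>\<^bsub>T_hom \<delta> \<alpha> a b\<^esub> T_class \<delta> \<alpha> a b g"
  and class_scale: "typed f a b \<Longrightarrow> T_class \<delta> \<alpha> a b (r *\<^sub>e f) = r \<odot>\<^bsub>T_hom \<delta> \<alpha> a b\<^esub> T_class \<delta> \<alpha> a b f"
  by (simp_all add: T_add T_smult)

lemma class_carrier: "typed f a b \<Longrightarrow> T_class \<delta> \<alpha> a b f \<in> carrier (T_hom \<delta> \<alpha> a b)"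
  by (simp add: T_hom_simps)

lemma scale_sum:
  assumes f: "typed f a b"
  shows "equ (p *\<^sub>e f +\<^sub>e (q *\<^sub>e f +\<^sub>e r *\<^sub>e f)) ((p + q + r) *\<^sub>e f) a b"
proof -
  have "equ ((p + q + r) *\<^sub>e f) ((p + q) *\<^sub>e f +\<^sub>e r *\<^sub>e f) a b"
    by (rule T_cong.add_scale f | (simp; fail))+
  also have "equ ((p + q) *\<^sub>e f +\<^sub>e r *\<^sub>e f) (p *\<^sub>e f +\<^sub>e q *\<^sub>e f +\<^sub>e r *\<^sub>e f) a b"
    by (rule T_cong.add_cong T_cong.add_scale T_cong.refl typed_rules f | (simp; fail))+
  also have "equ (p *\<^sub>e f +\<^sub>e q *\<^sub>e f +\<^sub>e r *\<^sub>e f) (p *\<^sub>e f +\<^sub>e (q *\<^sub>e f +\<^sub>e r *\<^sub>e f)) a b"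
    by (rule T_cong.add_assoc typed_rules f | (simp; fail))+
  finally show ?thesis by (rule T_cong.sym)
qed

lemma cupcap_s: "equ (cupcap \<circ>\<^sub>e GenS) cupcap 2 2"
proof -
  have "equ (cupcap \<circ>\<^sub>e GenS) (GenEta \<circ>\<^sub>e (GenEps \<circ>\<^sub>e GenS)) 2 2"
    unfolding cupcap_def by (rule T_cong.comp_assoc typed_rules | (simp; fail))+
  also have "equ (GenEta \<circ>\<^sub>e (GenEps \<circ>\<^sub>e GenS)) cupcap 2 2"
    unfolding cupcap_def by (rule equ_comp2 T_cong.rel T_rel.eps_symmetric typed_rules | (simp; fail))+
  finally show ?thesis .
qed

lemma cupcap_cupcap: "equ (cupcap \<circ>\<^sub>e cupcap) (\<delta> *\<^sub>e cupcap) 2 2"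
proof -
  have "equ (cupcap \<circ>\<^sub>e cupcap) (GenEta \<circ>\<^sub>e (GenEps \<circ>\<^sub>e (GenEta \<circ>\<^sub>e GenEps))) 2 2"
    unfolding cupcap_def by (rule T_cong.comp_assoc typed_rules | (simp; fail))+
  also have "equ (GenEta \<circ>\<^sub>e (GenEps \<circ>\<^sub>e (GenEta \<circ>\<^sub>e GenEps))) (GenEta \<circ>\<^sub>e (GenEps \<circ>\<^sub>e GenEta \<circ>\<^sub>e GenEps)) 2 2"
    by (rule equ_comp2 T_cong.comp_assoc[THEN T_cong.sym] typed_rules | (simp; fail))+
  also have "equ (GenEta \<circ>\<^sub>e (GenEps \<circ>\<^sub>e GenEta \<circ>\<^sub>e GenEps)) (GenEta \<circ>\<^sub>e ((\<delta> *\<^sub>e EId 0) \<circ>\<^sub>e GenEps)) 2 2"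
    by (rule equ_comp2 equ_comp1 T_cong.rel T_rel.eps_eta typed_rules | (simp; fail))+
  also have "equ (GenEta \<circ>\<^sub>e ((\<delta> *\<^sub>e EId 0) \<circ>\<^sub>e GenEps)) (GenEta \<circ>\<^sub>e (\<delta> *\<^sub>e (EId 0 \<circ>\<^sub>e GenEps))) 2 2"
    by (rule equ_comp2 T_cong.comp_scale_left typed_rules | (simp; fail))+
  also have "equ (GenEta \<circ>\<^sub>e (\<delta> *\<^sub>e (EId 0 \<circ>\<^sub>e GenEps))) (GenEta \<circ>\<^sub>e (\<delta> *\<^sub>e GenEps)) 2 2"
    by (rule equ_comp2 T_cong.scale_cong T_cong.id_left typed_rules | (simp; fail))+
  also have "equ (GenEta \<circ>\<^sub>e (\<delta> *\<^sub>e GenEps)) (\<delta> *\<^sub>e cupcap) 2 2"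
    unfolding cupcap_def by (rule T_cong.comp_scale_right typed_rules | (simp; fail))+
  finally show ?thesis .
qed

context
  fixes I :: "nat \<Rightarrow> nat \<Rightarrow> 'k expr set set"
  assumes ideal: "tensor_ideal (T_cat \<delta> \<alpha>) I"
begin

section \<open>Relations modulo a tensor ideal\<close>

text \<open>
  The morphism denoted by \<open>f\<close> becomes zero in the quotient by the ideal.
\<close>

definition null :: "nat \<Rightarrow> nat \<Rightarrow> 'k expr \<Rightarrow> bool" where
  "null a b f \<longleftrightarrow> typed f a b \<and> T_class \<delta> \<alpha> a b f \<in> I a b"

lemma subspace_I: "VectorSpace.subspace class_ring (I a b) (T_hom \<delta> \<alpha> a b)"
  using ideal by (simp add: tensor_ideal_def T_cat_simps)

lemma null_cong: "equ f g a b \<Longrightarrow> null a b f \<longleftrightarrow> null a b g"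
  using T_class_eq[of \<delta> \<alpha> f g a b] T_cong_typed[of \<delta> \<alpha> f g a b] by (auto simp: null_def)

lemma null_comp_left:
  assumes "null a b f" "typed g b c"
  shows "null a c (g \<circ>\<^sub>e f)"
proof -
  have "Comp (T_cat \<delta> \<alpha>) a b c (T_class \<delta> \<alpha> b c g) (T_class \<delta> \<alpha> a b f) \<in> I a c"
    using ideal assms class_carrier unfolding tensor_ideal_def null_def by (auto simp: T_cat_simps)
  then show ?thesis using assms by (auto simp: null_def T_comp intro: typed.intros)
qed

lemma null_comp_right:
  assumes "null b c g" "typed f a b"
  shows "null a c (g \<circ>\<^sub>e f)"
proof -
  have "Comp (T_cat \<delta> \<alpha>) a b c (T_class \<delta> \<alpha> b c g) (T_class \<delta> \<alpha> a b f) \<in> I a c"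
    using ideal assms class_carrier unfolding tensor_ideal_def null_def by (auto simp: T_cat_simps)
  then show ?thesis using assms by (auto simp: null_def T_comp intro: typed.intros)
qed

lemma null_ten_left:
  assumes "null a b f"
  shows "null (c + a) (c + b) (EId c \<otimes>\<^sub>e f)"
proof -
  have "Ten (T_cat \<delta> \<alpha>) c c a b (T_class \<delta> \<alpha> c c (EId c)) (T_class \<delta> \<alpha> a b f) \<in> I (c + a) (c + b)"
    using ideal assms unfolding tensor_ideal_def null_def by (simp add: T_cat_simps)
  then show ?thesis using assms by (simp add: null_def T_ten typed.intros)
qed

lemma null_ten_right:
  assumes "null a b f"
  shows "null (a + c) (b + c) (f \<otimes>\<^sub>e EId c)"
proof -
  have "Ten (T_cat \<delta> \<alpha>) a b c c (T_class \<delta> \<alpha> a b f) (T_class \<delta> \<alpha> c c (EId c)) \<in> I (a + c) (b + c)"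
    using ideal assms unfolding tensor_ideal_def null_def by (simp add: T_cat_simps)
  then show ?thesis using assms by (simp add: null_def T_ten typed.intros)
qed

lemma null_add: "\<lbrakk>null a b f; null a b g\<rbrakk> \<Longrightarrow> null a b (f +\<^sub>e g)"
  using submodule_of_subspace(5)[OF subspace_I] by (auto simp: null_def class_add intro: typed.intros)

lemma null_scale: "null a b f \<Longrightarrow> null a b (r *\<^sub>e f)"
  using submodule_of_subspace(6)[OF subspace_I] by (auto simp: null_def class_scale intro: typed.intros)

lemma null_scaleD:
  assumes "null a b (r *\<^sub>e f)" "typed f a b" "r \<noteq> 0"
  shows "null a b f"
proof -
  have "equ (inverse r *\<^sub>e r *\<^sub>e f) ((inverse r * r) *\<^sub>e f) a b"
    by (rule T_cong.scale_scale[THEN T_cong.sym] assms(2) | (simp; fail))+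
  also have "equ ((inverse r * r) *\<^sub>e f) f a b"
    using assms(3) T_cong.one_scale[OF assms(2)] by simp
  finally show ?thesis using null_scale[OF assms(1)] null_cong by blast
qed

lemma null_id1: "null 1 1 \<one>\<^sub>e \<Longrightarrow> null 2 2 (EId 2)"
  using null_ten_left[of 1 1 "\<one>\<^sub>e" 1] null_cong[OF equ_id2] by (simp add: numeral_2_eq_2)

text \<open>
  From \<open>m\<close> the relation \<open>m \<sigma> = \<alpha> 1\<close> recovers the identity, and from \<open>\<epsilon>\<close> a zigzag relation does. An
  ideal containing either thus contains the identities of \<open>X\<close> and of \<open>X \<otimes> X\<close>.
\<close>

lemma null_m:
  assumes "null 2 1 GenM" "\<alpha> \<noteq> 0"
  shows "null 2 2 (EId 2)"
proof -
  have "typed (sigma :: 'k expr) 1 2"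
    unfolding sigma_def by (rule typed_rules | (simp; fail))+
  then have "null 1 1 (\<alpha> *\<^sub>e \<one>\<^sub>e)"
    using null_comp_right[OF assms(1)] null_cong[OF T_cong.rel[OF T_rel.m_sigma]] by blast
  then show ?thesis
    using null_scaleD[OF _ typed.intros(5) assms(2)] null_id1 by blast
qed

lemma null_eps:
  assumes "null 2 0 GenEps"
  shows "null 2 2 (EId 2)"
proof -
  have "null 3 1 (GenEps \<otimes>\<^sub>e \<one>\<^sub>e)"
    using null_ten_right[OF assms, of 1] by (simp add: numeral_3_eq_3)
  moreover have "typed (\<one>\<^sub>e \<otimes>\<^sub>e GenEta) 1 3"
    by (rule typed_rules | (simp; fail))+
  ultimately have "null 1 1 \<one>\<^sub>e"
    using null_comp_right null_cong[OF T_cong.rel[OF T_rel.zigzag_left]] by blast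
  then show ?thesis by (rule null_id1)
qed

text \<open>
  The quarter turn is built from \<open>f\<close> by tensoring with identities and composing, which a tensor ideal
  allows.
\<close>

lemma null_rotate:
  assumes "null 2 2 f"
  shows "null 2 2 (rotate f)"
proof -
  have "null 3 3 (f \<otimes>\<^sub>e \<one>\<^sub>e)"
    using null_ten_right[OF assms, of 1] by (simp add: numeral_3_eq_3)
  moreover have "typed (\<one>\<^sub>e \<otimes>\<^sub>e GenEps) 3 1"
    by (rule typed_rules | (simp; fail))+
  ultimately have "null 3 1 ((\<one>\<^sub>e \<otimes>\<^sub>e GenEps) \<circ>\<^sub>e (f \<otimes>\<^sub>e \<one>\<^sub>e))"
    by (rule null_comp_left)
  from null_ten_left[OF this, of 1]
  have "null 4 2 (\<one>\<^sub>e \<otimes>\<^sub>e ((\<one>\<^sub>e \<otimes>\<^sub>e GenEps) \<circ>\<^sub>e (f \<otimes>\<^sub>e \<one>\<^sub>e)))"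
    by (simp del: One_nat_def)
  moreover have "typed (GenEta \<otimes>\<^sub>e EId 2) 2 4"
    by (rule typed_rules | (simp; fail))+
  ultimately show ?thesis
    unfolding rotate_def by (rule null_comp_right)
qed

text \<open>
  Precomposition with \<open>s\<close> uses \<open>s s = 1\<close> and \<open>u s = \<eta> \<epsilon> s = u\<close>.
\<close>

lemma null_comb_swap_id_s:
  assumes "null 2 2 (comb p q r)"
  shows "null 2 2 (comb q p r)"
proof -
  have "equ (comb p q r \<circ>\<^sub>e GenS) (p *\<^sub>e GenS +\<^sub>e (q *\<^sub>e EId 2 +\<^sub>e r *\<^sub>e cupcap)) 2 2"
    by (rule linear_image_comb[where F = "\<lambda>f. f \<circ>\<^sub>e GenS"])
      (rule T_cong.comp_add_left T_cong.comp_scale_left T_cong.id_left cupcap_s typed_rules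
        T_cong.trans[OF T_cong.rel[OF T_rel.s_involution] equ_id2] | assumption)+
  then have "null 2 2 (p *\<^sub>e GenS +\<^sub>e (q *\<^sub>e EId 2 +\<^sub>e r *\<^sub>e cupcap))"
    using null_comp_right[OF assms typed.intros(2)] null_cong by blast
  moreover interpret V: Module.module class_ring "T_hom \<delta> \<alpha> 2 2"
    using submodule_of_subspace(1)[OF subspace_I] .
  have "T_class \<delta> \<alpha> 2 2 (p *\<^sub>e GenS +\<^sub>e (q *\<^sub>e EId 2 +\<^sub>e r *\<^sub>e cupcap)) = T_class \<delta> \<alpha> 2 2 (comb q p r)"
    by (simp add: comb_def class_add class_scale class_carrier typed.intros typed_cupcap V.a_lcomm)
  ultimately show ?thesis
    using typed_comb by (simp add: null_def)
qed

lemma null_comb_swap_id_cupcap: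
  assumes "null 2 2 (comb p q r)"
  shows "null 2 2 (comb r q p)"
proof -
  have "equ (rotate (comb p q r)) (p *\<^sub>e cupcap +\<^sub>e (q *\<^sub>e GenS +\<^sub>e r *\<^sub>e EId 2)) 2 2"
    by (rule linear_image_comb rotate_add rotate_scale rotate_id rotate_s rotate_cupcap | (simp; fail))+
  then have "null 2 2 (p *\<^sub>e cupcap +\<^sub>e (q *\<^sub>e GenS +\<^sub>e r *\<^sub>e EId 2))"
    using null_rotate[OF assms] null_cong by blast
  moreover interpret V: Module.module class_ring "T_hom \<delta> \<alpha> 2 2"
    using submodule_of_subspace(1)[OF subspace_I] .
  have "T_class \<delta> \<alpha> 2 2 (p *\<^sub>e cupcap +\<^sub>e (q *\<^sub>e GenS +\<^sub>e r *\<^sub>e EId 2)) = T_class \<delta> \<alpha> 2 2 (comb r q p)"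
    by (simp add: comb_def class_add class_scale class_carrier typed.intros typed_cupcap V.a_ac)
  ultimately show ?thesis
    using typed_comb by (simp add: null_def)
qed

lemma null_comb_diff:
  assumes "null 2 2 (comb p q r)" "null 2 2 (comb p' q' r')"
  shows "null 2 2 (comb (p - p') (q - q') (r - r'))"
proof -
  have "null 2 2 (comb p q r +\<^sub>e (- 1) *\<^sub>e comb p' q' r')"
    by (intro null_add null_scale assms)
  moreover interpret V: Module.module class_ring "T_hom \<delta> \<alpha> 2 2"
    using submodule_of_subspace(1)[OF subspace_I] .
  have diff: "(c - d) \<odot>\<^bsub>T_hom \<delta> \<alpha> 2 2\<^esub> v =
      c \<odot>\<^bsub>T_hom \<delta> \<alpha> 2 2\<^esub> v \<oplus>\<^bsub>T_hom \<delta> \<alpha> 2 2\<^esub> ((- d) \<odot>\<^bsub>T_hom \<delta> \<alpha> 2 2\<^esub> v)"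
    and neg: "(- 1) \<odot>\<^bsub>T_hom \<delta> \<alpha> 2 2\<^esub> (d \<odot>\<^bsub>T_hom \<delta> \<alpha> 2 2\<^esub> v) = (- d) \<odot>\<^bsub>T_hom \<delta> \<alpha> 2 2\<^esub> v"
    if "v \<in> carrier (T_hom \<delta> \<alpha> 2 2)" for c d v
    using that V.smult_l_distr[of c "- d" v] V.smult_assoc1[of "- 1" d v] by simp_all
  have "T_class \<delta> \<alpha> 2 2 (comb p q r +\<^sub>e (- 1) *\<^sub>e comb p' q' r') =
      T_class \<delta> \<alpha> 2 2 (comb (p - p') (q - q') (r - r'))"
    by (simp add: comb_def class_add class_scale class_carrier typed.intros typed_cupcap V.a_ac
        V.smult_r_distr diff neg)
  ultimately show ?thesis
    using typed_comb by (simp add: null_def)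
qed

text \<open>
  The scalar \<open>p + q + r \<delta>\<close> is the factor by which \<open>u\<close> is multiplied in \<open>u (p 1 + q s + r u)\<close>, since \<open>u s = u\<close> and
  \<open>u u = \<delta> u\<close>.
\<close>

lemma null_comb_cupcap:
  assumes "null 2 2 (comb p q r)" "p + q + r * \<delta> \<noteq> 0"
  shows "null 2 2 cupcap"
proof -
  have "equ (cupcap \<circ>\<^sub>e comb p q r) (p *\<^sub>e cupcap +\<^sub>e (q *\<^sub>e cupcap +\<^sub>e r *\<^sub>e \<delta> *\<^sub>e cupcap)) 2 2"
    by (rule comp_left_comb typed_cupcap T_cong.refl cupcap_s cupcap_cupcap | (simp; fail))+
  also have "equ (p *\<^sub>e cupcap +\<^sub>e (q *\<^sub>e cupcap +\<^sub>e r *\<^sub>e \<delta> *\<^sub>e cupcap))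
      (p *\<^sub>e cupcap +\<^sub>e (q *\<^sub>e cupcap +\<^sub>e (r * \<delta>) *\<^sub>e cupcap)) 2 2"
    by (rule T_cong.add_cong T_cong.refl T_cong.scale_scale[THEN T_cong.sym] typed_rules typed_cupcap | (simp; fail))+
  also have "equ (p *\<^sub>e cupcap +\<^sub>e (q *\<^sub>e cupcap +\<^sub>e (r * \<delta>) *\<^sub>e cupcap)) ((p + q + r * \<delta>) *\<^sub>e cupcap) 2 2"
    by (rule scale_sum typed_cupcap | (simp; fail))+
  finally show ?thesis
    using null_comp_left[OF assms(1) typed_cupcap] null_cong null_scaleD[OF _ typed_cupcap assms(2)]
    by blast
qed

text \<open>
  Right multiplication by \<open>s\<close> has \<open>m\<close> and \<open>\<epsilon>\<close> as eigenvectors with eigenvalues \<open>-1\<close> and \<open>1\<close>, which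
  differ outside characteristic 2, so no non-trivial polynomial of degree at most one in \<open>s\<close> vanishes.
\<close>

lemma id_s_independent:
  assumes char: "(2 :: 'k) \<noteq> 0" and \<alpha>: "\<alpha> \<noteq> 0" and nontrivial: "\<not> null 2 2 (EId 2)"
    and null: "null 2 2 (comb p q 0)"
  shows "p = 0 \<and> q = 0"
proof -
  \<comment> \<open>An eigenvalue \<open>c\<close> with a surviving eigenvector \<open>h\<close> is a root of \<open>p + q x\<close>.\<close>
  have key: "p + q * c = 0"
    if h: "typed h 2 n" "\<not> null 2 n h" and hs: "equ (h \<circ>\<^sub>e GenS) (c *\<^sub>e h) 2 n" for h n c
  proof (rule ccontr)
    assume ne: "p + q * c \<noteq> 0"
    have hu: "typed (h \<circ>\<^sub>e cupcap) 2 n"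
      by (rule typed_rules typed_cupcap h | (simp; fail))+
    have "equ (h \<circ>\<^sub>e comb p q 0) (p *\<^sub>e h +\<^sub>e (q *\<^sub>e c *\<^sub>e h +\<^sub>e 0 *\<^sub>e (h \<circ>\<^sub>e cupcap))) 2 n"
      by (rule comp_left_comb T_cong.refl hs hu h | (simp; fail))+
    then have "null 2 n (p *\<^sub>e h +\<^sub>e (q *\<^sub>e c *\<^sub>e h +\<^sub>e 0 *\<^sub>e (h \<circ>\<^sub>e cupcap)))"
      using null_comp_left[OF null h(1)] null_cong by blast
    moreover interpret V: Module.module class_ring "T_hom \<delta> \<alpha> 2 n"
      using submodule_of_subspace(1)[OF subspace_I] .
    have "T_class \<delta> \<alpha> 2 n (p *\<^sub>e h +\<^sub>e (q *\<^sub>e c *\<^sub>e h +\<^sub>e 0 *\<^sub>e (h \<circ>\<^sub>e cupcap))) =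
        T_class \<delta> \<alpha> 2 n ((p + q * c) *\<^sub>e h)"
      using V.smult_l_null[OF class_carrier[OF hu]] V.smult_l_distr[of p "q * c" "T_class \<delta> \<alpha> 2 n h"]
        V.smult_assoc1[of q c "T_class \<delta> \<alpha> 2 n h"] class_carrier[OF h(1)]
      by (simp add: class_add class_scale class_carrier typed.intros(9,10) h hu)
    ultimately have "null 2 n ((p + q * c) *\<^sub>e h)"
      using h(1) by (simp add: null_def typed.intros)
    then show False
      using null_scaleD[OF _ h(1) ne] h(2) by blast
  qed
  have "p + q * - 1 = 0"
    using key[OF typed.intros(1) _ T_cong.rel[OF T_rel.m_antisymmetric]] null_m \<alpha> nontrivial by blast
  moreover have "equ (GenEps \<circ>\<^sub>e GenS) (1 *\<^sub>e GenEps) 2 0"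
    by (rule T_cong.trans[OF T_cong.rel[OF T_rel.eps_symmetric]]
        T_cong.one_scale[THEN T_cong.sym] typed_rules | (simp; fail))+
  then have "p + q * 1 = 0"
    using key[OF typed.intros(4)] null_eps nontrivial by blast
  ultimately have "p = q" "2 * q = 0" by simp_all
  then show ?thesis using char by simp
qed

text \<open>
  Antisymmetrising a relation under a symmetry removes the fixed element and leaves \<open>id_s_independent\<close>
  to conclude. Only multiples of \<open>1 + s + u\<close> escape this argument, and \<open>u\<close> detects them when \<open>\<delta> \<noteq> - 2\<close>.
\<close>

lemma comb_independent:
  assumes char: "(2 :: 'k) \<noteq> 0" and \<alpha>: "\<alpha> \<noteq> 0" and \<delta>: "\<delta> \<noteq> - 2"
    and nontrivial: "\<not> null 2 2 (EId 2)" and null: "null 2 2 (comb p q r)"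
  shows "p = 0 \<and> q = 0 \<and> r = 0"
proof -
  note indep = id_s_independent[OF char \<alpha> nontrivial]
  have "null 2 2 (comb (p - q) (q - p) 0)"
    using null_comb_diff[OF null null_comb_swap_id_s[OF null]] by simp
  then have pq: "p = q" using indep by fastforce
  \<comment> \<open>A relation between \<open>1\<close> and \<open>u\<close> is carried to one between \<open>1\<close> and \<open>s\<close> by both symmetries in turn.\<close>
  have "null 2 2 (comb (p - r) 0 (r - p))"
    using null_comb_diff[OF null null_comb_swap_id_cupcap[OF null]] by simp
  then have "null 2 2 (comb (r - p) (p - r) 0)"
    by (rule null_comb_swap_id_cupcap[OF null_comb_swap_id_s])
  then have pr: "p = r" using indep by fastforce
  have "p = 0"
  proof (rule ccontr)
    assume "p \<noteq> 0"
    moreover have "\<delta> + 2 \<noteq> 0" using \<delta> by (simp add: add_eq_0_iff2)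
    moreover have "p + q + r * \<delta> = p * (\<delta> + 2)"
      using pq pr by (simp add: distrib_left mult_2_right)
    ultimately have "p + q + r * \<delta> \<noteq> 0" by simp
    with null have "null 2 2 cupcap" by (rule null_comb_cupcap)
    then have "null 2 2 (rotate cupcap)" by (rule null_rotate)
    then show False using nontrivial null_cong[OF rotate_cupcap] by blast
  qed
  then show ?thesis using pq pr by simp
qed

end

end

section \<open>The dimension of the quotient\<close>

text \<open>
  Stated for a family rather than a set: if two of the vectors coincide, their difference is a
  relation, and otherwise they form a set with more elements than the dimension.
\<close>

lemma (in vectorspace) three_vectors_dependent:
  assumes fd: "fin_dim" and dim: "dim \<le> 2"
    and x: "x \<in> carrier V" and y: "y \<in> carrier V" and z: "z \<in> carrier V"
  shows "\<exists>p\<in>carrier K. \<exists>q\<in>carrier K. \<exists>r\<in>carrier K. \<not> (p = \<zero>\<^bsub>K\<^esub> \<and> q = \<zero>\<^bsub>K\<^esub> \<and> r = \<zero>\<^bsub>K\<^esub>) \<and>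
    p \<odot>\<^bsub>V\<^esub> x \<oplus>\<^bsub>V\<^esub> (q \<odot>\<^bsub>V\<^esub> y \<oplus>\<^bsub>V\<^esub> r \<odot>\<^bsub>V\<^esub> z) = \<zero>\<^bsub>V\<^esub>"
proof -
  have cancel: "\<one>\<^bsub>K\<^esub> \<odot>\<^bsub>V\<^esub> v \<oplus>\<^bsub>V\<^esub> (\<ominus>\<^bsub>K\<^esub> \<one>\<^bsub>K\<^esub>) \<odot>\<^bsub>V\<^esub> v = \<zero>\<^bsub>V\<^esub>" if "v \<in> carrier V" for v
    using that smult_l_minus[of "\<one>\<^bsub>K\<^esub>" v] by (simp add: r_neg)
  consider "x = y" | "x = z" | "y = z" | "distinct [x, y, z]" by auto
  then show ?thesis
  proof cases
    case 1
    then show ?thesis using x z cancel[OF x]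
      by (intro bexI[of _ "\<one>\<^bsub>K\<^esub>"] bexI[of _ "\<ominus>\<^bsub>K\<^esub> \<one>\<^bsub>K\<^esub>"] bexI[of _ "\<zero>\<^bsub>K\<^esub>"]) auto
  next
    case 2
    then show ?thesis using x y cancel[OF x]
      by (intro bexI[of _ "\<one>\<^bsub>K\<^esub>"] bexI[of _ "\<ominus>\<^bsub>K\<^esub> \<one>\<^bsub>K\<^esub>"] bexI[of _ "\<zero>\<^bsub>K\<^esub>"]) auto
  next
    case 3
    then show ?thesis using x y cancel[OF y]
      by (intro bexI[of _ "\<one>\<^bsub>K\<^esub>"] bexI[of _ "\<ominus>\<^bsub>K\<^esub> \<one>\<^bsub>K\<^esub>"] bexI[of _ "\<zero>\<^bsub>K\<^esub>"]) auto
  next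
    case 4
    then have "card {x, y, z} = 3" by simp
    then have "lin_dep {x, y, z}"
      using li_le_dim(2)[OF fd, of "{x, y, z}"] dim x y z by auto
    then obtain c v where c: "c \<in> {x, y, z} \<rightarrow> carrier K" "lincomb c {x, y, z} = \<zero>\<^bsub>V\<^esub>"
      "v \<in> {x, y, z}" "c v \<noteq> \<zero>\<^bsub>K\<^esub>"
      using finite_lin_dep[of "{x, y, z}"] x y z by auto
    moreover have "lincomb c {x, y, z} = c x \<odot>\<^bsub>V\<^esub> x \<oplus>\<^bsub>V\<^esub> (c y \<odot>\<^bsub>V\<^esub> y \<oplus>\<^bsub>V\<^esub> c z \<odot>\<^bsub>V\<^esub> z)"
      using 4 c(1) x y z by (simp add: lincomb_def)
    ultimately show ?thesis
      by (intro bexI[of _ "c x"] bexI[of _ "c y"] bexI[of _ "c z"]) auto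
  qed
qed

lemma (in vectorspace) dim_of_zero_space: "carrier V = {\<zero>\<^bsub>V\<^esub>} \<Longrightarrow> dim = 0"
  using gen_ge_dim[of "{}"] span_empty by simp

text \<open>
  If the identity of \<open>X \<otimes> X\<close> is null, so is every endomorphism. Otherwise a dimension of at most two
  would force a relation between the classes of \<open>1\<close>, \<open>s\<close> and \<open>u\<close>, against \<open>comb_independent\<close>.
\<close>

lemma End_X2_quotient_dim:
  fixes \<delta> \<alpha> :: "'k::field"
  assumes char: "(2 :: 'k) \<noteq> 0" and \<alpha>: "\<alpha> \<noteq> 0" and \<delta>: "\<delta> \<noteq> - 2"
    and ideal: "tensor_ideal (T_cat \<delta> \<alpha>) I"
  defines "V \<equiv> Hom (quotient_category (T_cat \<delta> \<alpha>) I) 2 2"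
  assumes fd: "vectorspace.fin_dim class_ring V" and dim: "vectorspace.dim class_ring V \<le> 2"
  shows "vectorspace.dim class_ring V = 0"
proof -
  note sub = subspace_I[OF ideal, of 2 2]
  have V: "V = quotient_module (T_hom \<delta> \<alpha> 2 2) (I 2 2)"
    by (simp add: V_def quotient_category_def T_cat_simps)
  interpret V: vectorspace class_ring V
    unfolding V by (rule quotient_vectorspace[OF sub])
  interpret T: Module.module class_ring "T_hom \<delta> \<alpha> 2 2"
    by (rule submodule_of_subspace(1)[OF sub])
  let ?c = "\<lambda>f. I 2 2 +>\<^bsub>T_hom \<delta> \<alpha> 2 2\<^esub> T_class \<delta> \<alpha> 2 2 f"
  note null_def = null_def[OF ideal]
  have c_carrier: "?c f \<in> carrier V" if "typed f 2 2" for f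
    using that by (auto simp: V quotient_carrier[OF sub] T_hom_simps)
  have c_null: "?c f = \<zero>\<^bsub>V\<^esub> \<longleftrightarrow> null \<delta> \<alpha> I 2 2 f" if f: "typed f 2 2" for f
  proof
    assume "?c f = \<zero>\<^bsub>V\<^esub>"
    then show "null \<delta> \<alpha> I 2 2 f"
      using f coset_mem[OF sub class_carrier[OF f]] by (simp add: V null_def quotient_module_def)
  next
    assume f_null: "null \<delta> \<alpha> I 2 2 f"
    have "\<ominus>\<^bsub>T_hom \<delta> \<alpha> 2 2\<^esub> \<zero>\<^bsub>T_hom \<delta> \<alpha> 2 2\<^esub> = \<zero>\<^bsub>T_hom \<delta> \<alpha> 2 2\<^esub>"
      using T.r_neg[OF T.zero_closed] by simp
    then have "T_class \<delta> \<alpha> 2 2 f \<ominus>\<^bsub>T_hom \<delta> \<alpha> 2 2\<^esub> \<zero>\<^bsub>T_hom \<delta> \<alpha> 2 2\<^esub> = T_class \<delta> \<alpha> 2 2 f"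
      using class_carrier[OF f, of \<delta> \<alpha>] by (simp add: a_minus_def)
    then have "T_class \<delta> \<alpha> 2 2 f \<ominus>\<^bsub>T_hom \<delta> \<alpha> 2 2\<^esub> \<zero>\<^bsub>T_hom \<delta> \<alpha> 2 2\<^esub> \<in> I 2 2"
      using f_null by (simp add: null_def)
    then show "?c f = \<zero>\<^bsub>V\<^esub>"
      unfolding V quotient_zero[OF sub]
      by (rule coset_eqI[OF sub T.zero_closed class_carrier[OF f]])
  qed
  have c_comb: "?c (comb p q r) = p \<odot>\<^bsub>V\<^esub> ?c (EId 2) \<oplus>\<^bsub>V\<^esub> (q \<odot>\<^bsub>V\<^esub> ?c GenS \<oplus>\<^bsub>V\<^esub> r \<odot>\<^bsub>V\<^esub> ?c cupcap)" for p q r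
    by (simp add: V comb_def quotient_add[OF sub] quotient_smult[OF sub] class_add class_scale
        class_carrier typed.intros typed_cupcap)
  show ?thesis
  proof (cases "null \<delta> \<alpha> I 2 2 (EId 2)")
    case True
    have "null \<delta> \<alpha> I 2 2 f" if f: "typed f 2 2" for f
      using null_comp_left[OF ideal True f] null_cong[OF ideal T_cong.id_right[OF f]] by blast
    then have "carrier V = {\<zero>\<^bsub>V\<^esub>}"
      using c_null c_carrier[OF typed.intros(5)] by (force simp: V quotient_carrier[OF sub] T_hom_simps)
    then show ?thesis by (rule V.dim_of_zero_space)
  next
    case False
    obtain p q r where pqr: "\<not> (p = 0 \<and> q = 0 \<and> r = 0)" "?c (comb p q r) = \<zero>\<^bsub>V\<^esub>"
      using V.three_vectors_dependent[OF fd dim c_carrier c_carrier c_carrier, of "EId 2" GenS cupcap]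
      by (auto simp: c_comb typed.intros typed_cupcap)
    then show ?thesis
      using comb_independent[OF ideal char \<alpha> \<delta> False] c_null[OF typed_comb] by blast
  qed
qed

theorem corollary3p7:
  fixes \<delta> \<alpha> :: "'k::field"
  assumes "CHAR('k) \<noteq> 2" and "\<delta> \<noteq> - 2" and "\<alpha> \<noteq> 0"
  shows "\<not> (\<exists>I. tensor_ideal (T_cat \<delta> \<alpha>) I \<and>
    vectorspace.fin_dim class_ring (Hom (quotient_category (T_cat \<delta> \<alpha>) I) 2 2) \<and>
    vectorspace.dim class_ring (Hom (quotient_category (T_cat \<delta> \<alpha>) I) 2 2) \<in> {1, 2})"
proof -
  have "(2 :: 'k) \<noteq> 0"
  proof
    assume "(2 :: 'k) = 0"
    then have "CHAR('k) dvd 2" using of_nat_eq_0_iff_char_dvd[where 'a = 'k, of 2] by simp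
    moreover have "CHAR('k) \<noteq> 1" by simp
    ultimately show False using assms(1) two_is_prime_nat by (metis prime_nat_iff)
  qed
  then show ?thesis
    using End_X2_quotient_dim[OF _ assms(3,2)] by fastforce
qed

end
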